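(* For $N\ge1$ let $$Z_{\mathrm{4D}}(\boldsymbol{T},X_1,\ldots,X_N)=\sum_{\lambda\in\mathcal{P}}\left(\frac{\dim\lambda}{|\lambda|!}\right)^2\left(\frac{\Lambda}{\hbar}\right)^{2|\lambda|}\exp\Big(\sum_{k=1}^\infty T_k\phi^{\mathrm{4D}}_k(\lambda)\Big)\prod_{j=1}^N\prod_{i=1}^\infty\frac{X_j-(\lambda_i-i+1)\hbar}{X_j-(-i+1)\hbar}.$$ Then the following three-term (Fay-type) bilinear equation holds: $$\begin{aligned}&(X_1-X_2)(X_3-X_4)\,Z_{\mathrm{4D}}(\boldsymbol{T},X_1,X_2)\,Z_{\mathrm{4D}}(\boldsymbol{T},X_3,X_4)\\&-(X_1-X_3)(X_2-X_4)\,Z_{\mathrm{4D}}(\boldsymbol{T},X_1,X_3)\,Z_{\mathrm{4D}}(\boldsymbol{T},X_2,X_4)\\&+(X_1-X_4)(X_2-X_3)\,Z_{\mathrm{4D}}(\boldsymbol{T},X_1,X_4)\,Z_{\mathrm{4D}}(\boldsymbol{T},X_2,X_3)=0.\end{aligned}$$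
   Context: $\mathcal{P}$ is the set of all partitions $\lambda=(\lambda_1\ge\lambda_2\ge\cdots\ge0)$ with finitely many nonzero parts, $|\lambda|=\sum_i\lambda_i$, $\dim\lambda$ is the number of standard Young tableaux of shape $\lambda$, $\boldsymbol{T}=(T_1,T_2,\ldots)$, and $$\phi^{\mathrm{4D}}_k(\lambda)=\sum_{i=1}^\infty\big((\lambda_i-i+1)^k-(-i+1)^k\big).$$ The sums and products over $i$ have only finitely many nontrivial terms. All functions are regarded as formal power series in $\Lambda^2$ and $T_1,T_2,\ldots$ with coefficients that are rational functions of the $X_j$'s ($\hbar\ne0$ a parameter). *)

theory Defs
  imports
    Complex_Main
    "HOL-Library.Poly_Mapping"
    "HOL-Library.FuncSet"
    "HOL-Computational_Algebra.Polynomial_Factorial"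
begin

section \<open>Formal power series in arbitrarily many variables\<close>

text \<open>A monomial in variables of type \<^typ>\<open>'v\<close> is a finitely supported exponent vector
  \<^typ>\<open>'v \<Rightarrow>\<^sub>0 nat\<close>; a formal power series assigns a coefficient to every monomial.\<close>

typedef ('v, 'a) mps = "UNIV :: (('v \<Rightarrow>\<^sub>0 nat) \<Rightarrow> 'a) set"
  morphisms mps_coeff Abs_mps ..

setup_lifting type_definition_mps

lemma mps_coeff_Abs [simp]: "mps_coeff (Abs_mps f) = f"
  by (simp add: Abs_mps_inverse)

lemma mps_eqI: "(\<And>m. mps_coeff f m = mps_coeff g m) \<Longrightarrow> f = g"
  by (metis ext mps_coeff_inject)

lemma finite_decompositions:
  fixes m :: "'v \<Rightarrow>\<^sub>0 nat"
  shows "finite {(a, b). a + b = m}"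
proof -
  let ?B = "{f. \<forall>x. (x \<in> Poly_Mapping.keys m \<longrightarrow> f x \<in> (\<Union>y\<in>Poly_Mapping.keys m. {0..Poly_Mapping.lookup m y})) \<and> (x \<notin> Poly_Mapping.keys m \<longrightarrow> f x = 0)}"
  have fin: "finite ?B"
    by (rule finite_set_of_finite_funs) (simp_all add: finite_keys)
  have sub: "Poly_Mapping.lookup ` {a. \<exists>b. a + b = m} \<subseteq> ?B"
  proof (intro image_subsetI CollectI allI conjI impI)
    fix a x assume "a \<in> {a. \<exists>b. a + b = m}"
    then obtain b where b: "m = a + b" by auto
    { assume "x \<in> Poly_Mapping.keys m"
      moreover have "Poly_Mapping.lookup a x \<le> Poly_Mapping.lookup m x" by (simp add: b lookup_add)
      ultimately show "Poly_Mapping.lookup a x \<in> (\<Union>y\<in>Poly_Mapping.keys m. {0..Poly_Mapping.lookup m y})" by auto }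
    { assume "x \<notin> Poly_Mapping.keys m"
      then show "Poly_Mapping.lookup a x = 0" by (simp add: b lookup_add in_keys_iff) }
  qed
  have "finite {a. \<exists>b. a + b = m}"
    by (rule finite_imageD[OF finite_subset[OF sub fin]])
      (rule inj_onI, simp only: poly_mapping_eq_iff)
  moreover have "{(a, b). a + b = m} \<subseteq> (\<lambda>a. (a, m - a)) ` {a. \<exists>b. a + b = m}"
    by auto
  ultimately show ?thesis
    by (meson finite_imageI finite_subset)
qed

instantiation mps :: (type, comm_ring_1) comm_ring_1
begin

lift_definition zero_mps :: "('a, 'b) mps" is "\<lambda>_. 0" .
lift_definition one_mps :: "('a, 'b) mps" is "\<lambda>m. if m = 0 then 1 else 0" .
lift_definition plus_mps :: "('a, 'b) mps \<Rightarrow> ('a, 'b) mps \<Rightarrow> ('a, 'b) mps"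
  is "\<lambda>f g m. f m + g m" .
lift_definition minus_mps :: "('a, 'b) mps \<Rightarrow> ('a, 'b) mps \<Rightarrow> ('a, 'b) mps"
  is "\<lambda>f g m. f m - g m" .
lift_definition uminus_mps :: "('a, 'b) mps \<Rightarrow> ('a, 'b) mps"
  is "\<lambda>f m. - f m" .
lift_definition times_mps :: "('a, 'b) mps \<Rightarrow> ('a, 'b) mps \<Rightarrow> ('a, 'b) mps"
  is "\<lambda>f g m. \<Sum>(a, b) | a + b = m. f a * g b" .

instance
proof
  fix f g h :: "('a, 'b) mps"
  show "f + g + h = f + (g + h)" by transfer (simp add: algebra_simps)
  show "f + g = g + f" by transfer (simp add: algebra_simps)
  show "0 + f = f" by transfer simp
  show "- f + f = 0" by transfer simp
  show "f - g = f + - g" by transfer simp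
  show "(0::('a, 'b) mps) \<noteq> 1" by transfer (auto dest: fun_cong[of _ _ 0])
  show "(f + g) * h = f * h + g * h"
    by transfer (simp add: algebra_simps case_prod_unfold sum.distrib)
  show "f * g = g * f"
  proof transfer
    fix f g :: "('a \<Rightarrow>\<^sub>0 nat) \<Rightarrow> 'b"
    show "(\<lambda>m. \<Sum>(a, b) | a + b = m. f a * g b) = (\<lambda>m. \<Sum>(a, b) | a + b = m. g a * f b)"
      by (rule ext, rule sum.reindex_bij_witness[of _ prod.swap prod.swap])
        (auto simp: add.commute mult.commute)
  qed
  show "1 * f = f"
  proof transfer
    fix f :: "('a \<Rightarrow>\<^sub>0 nat) \<Rightarrow> 'b"
    show "(\<lambda>m. \<Sum>(a, b) | a + b = m. (if a = 0 then 1 else 0) * f b) = f"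
    proof
      fix m :: "'a \<Rightarrow>\<^sub>0 nat"
      have "(\<Sum>(a, b) | a + b = m. (if a = 0 then 1 else 0) * f b)
          = (\<Sum>(a, b) \<in> {(0 :: 'a \<Rightarrow>\<^sub>0 nat, m)}. (if a = 0 then 1 else 0) * f b)"
        using finite_decompositions[of m] by (intro sum.mono_neutral_right) (auto split: if_splits)
      then show "(\<Sum>(a, b) | a + b = m. (if a = 0 then 1 else 0) * f b) = f m" by simp
    qed
  qed
  show "f * g * h = f * (g * h)"
  proof transfer
    fix f g h :: "('a \<Rightarrow>\<^sub>0 nat) \<Rightarrow> 'b"
    have "(\<Sum>(p, c) | p + c = m. (\<Sum>(a, b) | a + b = p. f a * g b) * h c)
        = (\<Sum>(a, q) | a + q = m. f a * (\<Sum>(b, c) | b + c = q. g b * h c))" for m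
    proof -
      have fin: "finite {x. fst x + snd x = p}" for p :: "'a \<Rightarrow>\<^sub>0 nat"
        using finite_decompositions[of p] by (simp add: case_prod_unfold)
      have "(\<Sum>(p, c) | p + c = m. (\<Sum>(a, b) | a + b = p. f a * g b) * h c)
          = (\<Sum>x | fst x + snd x = m. \<Sum>y | fst y + snd y = fst x.
               f (fst y) * g (snd y) * h (snd x))"
        by (simp add: case_prod_unfold sum_distrib_right)
      also have "\<dots> = (\<Sum>z\<in>(SIGMA x:{x. fst x + snd x = m}. {y. fst y + snd y = fst x}).
               f (fst (snd z)) * g (snd (snd z)) * h (snd (fst z)))"
        by (subst sum.Sigma) (simp_all add: fin case_prod_unfold)
      also have "\<dots> = (\<Sum>z\<in>(SIGMA x:{x. fst x + snd x = m}. {y. fst y + snd y = snd x}).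
               f (fst (fst z)) * (g (fst (snd z)) * h (snd (snd z))))"
        by (rule sum.reindex_bij_witness[of _
              "\<lambda>z. ((fst (fst z) + fst (snd z), snd (snd z)), (fst (fst z), fst (snd z)))"
              "\<lambda>z. ((fst (snd z), snd (snd z) + snd (fst z)), (snd (snd z), snd (fst z)))"])
          (auto simp: add.assoc mult.assoc)
      also have "\<dots> = (\<Sum>x | fst x + snd x = m. \<Sum>y | fst y + snd y = snd x.
               f (fst x) * (g (fst y) * h (snd y)))"
        by (subst sum.Sigma) (simp_all add: fin case_prod_unfold)
      also have "\<dots> = (\<Sum>(a, q) | a + q = m. f a * (\<Sum>(b, c) | b + c = q. g b * h c))"
        by (simp add: case_prod_unfold sum_distrib_left)
      finally show ?thesis .
    qed
    then show "(\<lambda>m. \<Sum>(p, c) | p + c = m. (\<Sum>(a, b) | a + b = p. f a * g b) * h c)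
        = (\<lambda>m. \<Sum>(a, q) | a + q = m. f a * (\<Sum>(b, c) | b + c = q. g b * h c))"
      by blast
  qed
qed

end

definition mps_const :: "'a::zero \<Rightarrow> ('v, 'a) mps" where
  "mps_const c = Abs_mps (\<lambda>m. if m = 0 then c else 0)"

definition mps_var :: "'v \<Rightarrow> ('v, 'a::zero_neq_one) mps" where
  "mps_var v = Abs_mps (\<lambda>m. if m = Poly_Mapping.single v 1 then 1 else 0)"

text \<open>Sums of possibly infinite families are taken coefficientwise. This is meaningful only for
  summable families, that is, if each coefficient receives finitely many nonzero contributions;
  \<^const>\<open>Sum_any\<close> yields 0 otherwise. Summability of the families used below is proved after
  the definition of the partition function.\<close>

definition mps_summable :: "('i \<Rightarrow> ('v, 'a::zero) mps) \<Rightarrow> 'i set \<Rightarrow> bool" where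
  "mps_summable f A \<longleftrightarrow> (\<forall>m. finite {i \<in> A. mps_coeff (f i) m \<noteq> 0})"

definition mps_sum :: "('i \<Rightarrow> ('v, 'a::comm_monoid_add) mps) \<Rightarrow> 'i set \<Rightarrow> ('v, 'a) mps" where
  "mps_sum f A = Abs_mps (\<lambda>m. Sum_any (\<lambda>i. if i \<in> A then mps_coeff (f i) m else 0))"

text \<open>The exponential series; its argument must have zero constant term.\<close>

definition mps_exp :: "('v, 'a::field) mps \<Rightarrow> ('v, 'a) mps" where
  "mps_exp f = mps_sum (\<lambda>n. mps_const (1 / of_nat (fact n)) * f ^ n) UNIV"


section \<open>Partitions\<close>

text \<open>Parts are indexed from 0, so the part \<open>\<lambda>\<^sub>i\<close> of the usual notation is \<open>lam (i - 1)\<close>,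
  and \<open>\<lambda>\<^sub>i - i + 1\<close> becomes \<open>lam i - i\<close>.\<close>

definition partitions :: "(nat \<Rightarrow> nat) set" where
  "partitions = {lam. antimono lam \<and> finite {i. lam i \<noteq> 0}}"

definition psize :: "(nat \<Rightarrow> nat) \<Rightarrow> nat" where
  "psize lam = Sum_any lam"

definition young_diagram :: "(nat \<Rightarrow> nat) \<Rightarrow> (nat \<times> nat) set" where
  "young_diagram lam = {(i, j). j < lam i}"

text \<open>Tableaux are made extensional, so that they can be counted.\<close>

definition standard_tableaux :: "(nat \<Rightarrow> nat) \<Rightarrow> (nat \<times> nat \<Rightarrow> nat) set" where
  "standard_tableaux lam =
     {t \<in> extensional (young_diagram lam).
        bij_betw t (young_diagram lam) {1..psize lam} \<and>
        (\<forall>i j j'. j < j' \<and> (i, j') \<in> young_diagram lam \<longrightarrow> t (i, j) < t (i, j')) \<and>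
        (\<forall>i i' j. i < i' \<and> (i', j) \<in> young_diagram lam \<longrightarrow> t (i, j) < t (i', j))}"

definition pdim :: "(nat \<Rightarrow> nat) \<Rightarrow> nat" where
  "pdim lam = card (standard_tableaux lam)"

definition phi_4D :: "nat \<Rightarrow> (nat \<Rightarrow> nat) \<Rightarrow> int" where
  "phi_4D k lam = Sum_any (\<lambda>i. (int (lam i) - int i) ^ k - (- int i) ^ k)"


section \<open>Rational functions in \<open>X\<^sub>1, X\<^sub>2, \<dots>\<close>\<close>

type_synonym 'a ratfun = "((nat \<Rightarrow>\<^sub>0 nat) \<Rightarrow>\<^sub>0 'a) fract"

definition rat_const :: "'a::idom \<Rightarrow> 'a ratfun" where
  "rat_const c = to_fract (Poly_Mapping.single 0 c)"

definition X :: "nat \<Rightarrow> 'a::idom ratfun" where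
  "X j = to_fract (Poly_Mapping.single (Poly_Mapping.single j 1) 1)"


section \<open>The partition function\<close>

text \<open>\<open>LambdaSq\<close> is the variable \<open>\<Lambda>\<^sup>2\<close> and \<open>Time k\<close> is \<open>T\<^sub>k\<close>; only \<open>k \<ge> 1\<close> is used.\<close>

datatype param = LambdaSq | Time nat

definition time_potential :: "(nat \<Rightarrow> nat) \<Rightarrow> (param, 'f::field) mps" where
  "time_potential lam = mps_sum (\<lambda>k. mps_var (Time k) * mps_const (of_int (phi_4D k lam))) {1..}"

text \<open>The list \<open>Xs\<close> holds the arguments \<open>X\<^sub>1, \<dots>, X\<^sub>N\<close>.\<close>

definition Z_4D_summand :: "'f::field \<Rightarrow> 'f list \<Rightarrow> (nat \<Rightarrow> nat) \<Rightarrow> (param, 'f) mps" where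
  "Z_4D_summand hbar Xs lam =
     mps_const ((of_nat (pdim lam) / of_nat (fact (psize lam)))\<^sup>2) *
     (mps_const ((1 / hbar) ^ (2 * psize lam)) * mps_var LambdaSq ^ psize lam) *
     mps_exp (time_potential lam) *
     mps_const (\<Prod>x\<leftarrow>Xs. Prod_any (\<lambda>i.
       (x - of_int (int (lam i) - int i) * hbar) / (x - of_int (- int i) * hbar)))"

definition Z_4D :: "'f::field \<Rightarrow> 'f list \<Rightarrow> (param, 'f) mps" where
  "Z_4D hbar Xs = mps_sum (Z_4D_summand hbar Xs) partitions"


subsection \<open>The families summed above are summable\<close>

lemma phi_4D_finite_support:
  assumes "lam \<in> partitions"
  shows "finite {i. (int (lam i) - int i) ^ k - (- int i) ^ k \<noteq> 0}"
proof (rule finite_subset)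
  show "{i. (int (lam i) - int i) ^ k - (- int i) ^ k \<noteq> 0} \<subseteq> {i. lam i \<noteq> 0}"
    by (intro Collect_mono impI notI) simp
  show "finite {i. lam i \<noteq> 0}" using assms by (simp add: partitions_def)
qed

lemma Z_4D_factor_finite_support:
  fixes x hbar :: "'f::field"
  assumes "lam \<in> partitions" and "\<And>n. x - of_int (- int n) * hbar \<noteq> 0"
  shows "finite {i. (x - of_int (int (lam i) - int i) * hbar) / (x - of_int (- int i) * hbar) \<noteq> 1}"
proof (rule finite_subset)
  show "{i. (x - of_int (int (lam i) - int i) * hbar) / (x - of_int (- int i) * hbar) \<noteq> 1}
      \<subseteq> {i. lam i \<noteq> 0}"
  proof (intro Collect_mono impI notI)
    fix i assume ne: "(x - of_int (int (lam i) - int i) * hbar) / (x - of_int (- int i) * hbar) \<noteq> 1"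
      and "lam i = 0"
    then have "int (lam i) - int i = - int i" by simp
    with ne assms(2)[of i] show False by (metis divide_self)
  qed
  show "finite {i. lam i \<noteq> 0}" using assms(1) by (simp add: partitions_def)
qed

lemma mps_coeff_mult:
  "mps_coeff (f * g) m = (\<Sum>(a, b) | a + b = m. mps_coeff f a * mps_coeff g b)"
  by (simp add: times_mps.rep_eq)

lemma mps_coeff_mult_nonzeroE:
  assumes "mps_coeff (f * g) m \<noteq> 0"
  obtains a b where "m = a + b" "mps_coeff f a \<noteq> 0" "mps_coeff g b \<noteq> 0"
proof -
  obtain x where "x \<in> {(a, b). a + b = m}"
      "(case x of (a, b) \<Rightarrow> mps_coeff f a * mps_coeff g b) \<noteq> 0"
    using assms unfolding mps_coeff_mult by (meson sum.not_neutral_contains_not_neutral)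
  then show ?thesis by (intro that[of "fst x" "snd x"]) (auto simp: case_prod_unfold)
qed

lemma mps_coeff_const: "mps_coeff (mps_const c) m = (if m = 0 then c else 0)"
  by (simp add: mps_const_def)

lemma mps_coeff_var: "mps_coeff (mps_var v) m = (if m = Poly_Mapping.single v 1 then 1 else 0)"
  by (simp add: mps_var_def)

lemma mps_coeff_var_mult_const:
  assumes "mps_coeff (mps_var v * mps_const c) m \<noteq> 0"
  shows "m = Poly_Mapping.single v 1"
  using assms by (rule mps_coeff_mult_nonzeroE) (metis add.right_neutral mps_coeff_const mps_coeff_var)

lemma time_potential_summable:
  "mps_summable (\<lambda>k. mps_var (Time k) * mps_const (of_int (phi_4D k lam)) :: (param, 'f::field) mps) A"
  unfolding mps_summable_def
proof
  fix m :: "param \<Rightarrow>\<^sub>0 nat"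
  define g :: "nat \<Rightarrow> (param, 'f) mps"
    where "g k = mps_var (Time k) * mps_const (of_int (phi_4D k lam))" for k
  have sub: "Time ` {k \<in> A. mps_coeff (g k) m \<noteq> 0} \<subseteq> Poly_Mapping.keys m"
  proof (rule image_subsetI)
    fix k assume "k \<in> {k \<in> A. mps_coeff (g k) m \<noteq> 0}"
    then have "mps_coeff (g k) m \<noteq> 0" by blast
    then have "m = Poly_Mapping.single (Time k) 1"
      unfolding g_def by (rule mps_coeff_var_mult_const)
    then show "Time k \<in> Poly_Mapping.keys m" by simp
  qed
  have "finite {k \<in> A. mps_coeff (g k) m \<noteq> 0}"
    by (rule finite_imageD[OF finite_subset[OF sub finite_keys]]) (rule inj_onI, simp)
  then show "finite {k \<in> A. mps_coeff (mps_var (Time k) * mps_const (of_int (phi_4D k lam))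
      :: (param, 'f) mps) m \<noteq> 0}"
    unfolding g_def .
qed

lemma mps_exp_summable:
  fixes f :: "('v, 'a::field) mps"
  assumes "mps_coeff f 0 = 0"
  shows "mps_summable (\<lambda>n. mps_const (1 / of_nat (fact n)) * f ^ n) UNIV"
  unfolding mps_summable_def
proof
  fix m :: "'v \<Rightarrow>\<^sub>0 nat"
  define deg where "deg = (\<lambda>m :: 'v \<Rightarrow>\<^sub>0 nat. Sum_any (Poly_Mapping.lookup m))"
  have deg_add: "deg (a + b) = deg a + deg b" for a b
    unfolding deg_def by (simp add: lookup_add Sum_any.distrib)
  have deg_pos: "deg a > 0" if "a \<noteq> 0" for a
  proof -
    have "Poly_Mapping.lookup a \<noteq> (\<lambda>_. 0)"
      using that unfolding poly_mapping_eq_iff by (simp add: fun_eq_iff)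
    then show ?thesis
      unfolding deg_def by (simp add: Sum_any_eq_zero_iff flip: neq0_conv)
  qed
  have pow: "n \<le> deg m" if "mps_coeff (f ^ n) m \<noteq> 0" for n m
    using that
  proof (induction n arbitrary: m)
    case (Suc n)
    from Suc.prems obtain a b where "m = a + b" "mps_coeff f a \<noteq> 0" "mps_coeff (f ^ n) b \<noteq> 0"
      unfolding power_Suc by (metis mps_coeff_mult_nonzeroE)
    moreover from this assms have "a \<noteq> 0" by auto
    ultimately show ?case using Suc.IH[of b] deg_pos[of a] by (simp add: deg_add)
  qed simp
  have "n \<le> deg m" if "mps_coeff (mps_const c * f ^ n) m \<noteq> 0" for n c
    using that by (rule mps_coeff_mult_nonzeroE) (metis add.left_neutral mps_coeff_const pow)
  then have "{n \<in> UNIV. mps_coeff (mps_const (1 / of_nat (fact n)) * f ^ n) m \<noteq> 0} \<subseteq> {..deg m}"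
    by blast
  then show "finite {n \<in> UNIV. mps_coeff (mps_const (1 / of_nat (fact n)) * f ^ n) m \<noteq> 0}"
    by (rule finite_subset) simp
qed

lemma mps_coeff_time_potential_0:
  "mps_coeff (time_potential lam :: (param, 'f::field) mps) 0 = 0"
proof -
  have "mps_coeff (mps_var (Time k) * mps_const c :: (param, 'f) mps) 0 = 0" for k c
  proof (rule ccontr)
    assume "mps_coeff (mps_var (Time k) * mps_const c :: (param, 'f) mps) 0 \<noteq> 0"
    then have "0 = Poly_Mapping.single (Time k) (1::nat)"
      by (rule mps_coeff_var_mult_const)
    then show False by (metis lookup_single_eq lookup_zero one_neq_zero)
  qed
  then show ?thesis by (simp add: time_potential_def mps_sum_def cong: if_cong)
qed

lemma finite_partitions_bounded: "finite {lam \<in> partitions. psize lam \<le> N}"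
proof (rule finite_subset)
  show "finite {f :: nat \<Rightarrow> nat. \<forall>i. (i \<in> {..N} \<longrightarrow> f i \<in> {..N}) \<and> (i \<notin> {..N} \<longrightarrow> f i = 0)}"
    by (rule finite_set_of_finite_funs) auto
  show "{lam \<in> partitions. psize lam \<le> N}
      \<subseteq> {f. \<forall>i. (i \<in> {..N} \<longrightarrow> f i \<in> {..N}) \<and> (i \<notin> {..N} \<longrightarrow> f i = 0)}"
  proof (intro subsetI CollectI allI)
    fix lam i assume "lam \<in> {lam \<in> partitions. psize lam \<le> N}"
    then have anti: "antimono lam" and fin: "finite {i. lam i \<noteq> 0}" and le: "psize lam \<le> N"
      by (auto simp: partitions_def)
    have bound: "sum lam B \<le> N" if "finite B" for B
    proof -
      have "sum lam B \<le> sum lam (B \<union> {i. lam i \<noteq> 0})"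
        using that fin by (intro sum_mono2) auto
      also have "\<dots> = psize lam"
        unfolding psize_def using that fin by (intro Sum_any.expand_superset[symmetric]) auto
      finally show ?thesis using le by simp
    qed
    have "lam i = 0" if "i > N"
    proof (rule ccontr)
      assume "lam i \<noteq> 0"
      then have "1 \<le> lam j" if "j \<le> i" for j
        using antimonoD[OF anti that] by simp
      then have "(\<Sum>j\<in>{..i}. 1) \<le> sum lam {..i}"
        by (intro sum_mono) auto
      with bound[of "{..i}"] \<open>i > N\<close> show False by simp
    qed
    with bound[of "{i}"] show "(i \<in> {..N} \<longrightarrow> lam i \<in> {..N}) \<and> (i \<notin> {..N} \<longrightarrow> lam i = 0)"
      by auto
  qed
qed

lemma Z_4D_summable: "mps_summable (Z_4D_summand hbar Xs) partitions"
  unfolding mps_summable_def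
proof
  fix m :: "param \<Rightarrow>\<^sub>0 nat"
  have pow: "n \<le> Poly_Mapping.lookup m LambdaSq"
    if "mps_coeff (mps_var LambdaSq ^ n :: (param, 'a) mps) m \<noteq> 0" for n m
    using that
  proof (induction n arbitrary: m)
    case (Suc n)
    from Suc.prems obtain b where "m = Poly_Mapping.single LambdaSq 1 + b"
        "mps_coeff (mps_var LambdaSq ^ n :: (param, 'a) mps) b \<noteq> 0"
      unfolding power_Suc by (elim mps_coeff_mult_nonzeroE) (metis mps_coeff_var)
    with Suc.IH[of b] show ?case by (simp add: lookup_add)
  qed simp
  have "psize lam \<le> Poly_Mapping.lookup m LambdaSq"
    if nz: "mps_coeff (Z_4D_summand hbar Xs lam) m \<noteq> 0" for lam
  proof -
    define v :: "(param, 'a) mps" where "v = mps_var LambdaSq ^ psize lam"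
    have comm: "x * (y * v) * z * w = v * (x * y * z * w)" for x y z w
      by (simp only: mult_ac)
    obtain c where "Z_4D_summand hbar Xs lam = v * c"
      unfolding Z_4D_summand_def v_def[symmetric] comm by blast
    with nz obtain a b where "m = a + b" "mps_coeff v a \<noteq> 0"
      by (metis mps_coeff_mult_nonzeroE)
    with pow[of "psize lam" a] show ?thesis by (simp add: lookup_add v_def)
  qed
  then have "{lam \<in> partitions. mps_coeff (Z_4D_summand hbar Xs lam) m \<noteq> 0}
      \<subseteq> {lam \<in> partitions. psize lam \<le> Poly_Mapping.lookup m LambdaSq}"
    by auto
  then show "finite {lam \<in> partitions. mps_coeff (Z_4D_summand hbar Xs lam) m \<noteq> 0}"
    by (rule finite_subset) (rule finite_partitions_bounded)
qed

end

theory Submission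
  imports Defs
begin

text \<open>
  Up to order \<open>n\<close> in \<open>\<Lambda>\<^sup>2\<close> only partitions inside the \<open>n \<times> n\<close> box contribute, and
  \<open>\<lambda> \<mapsto> S = {\<lambda>\<^sub>i + n - i}\<close> identifies these with the \<open>n\<close>-subsets of \<open>{0, \<dots>, 2n - 1}\<close>. Since
  \<open>dim \<lambda> / |\<lambda>|!\<close> is the Vandermonde product of \<open>S\<close> divided by \<open>\<Prod>\<^bsub>s\<in>S\<^esub> s!\<close>, the truncated partition
  function is a discrete matrix model: up to scalars it is
  \<open>\<Sum>\<^sub>S \<Omega>(S) \<Delta>(S)\<^sup>2 S(X\<^sub>1) S(X\<^sub>2)\<close>, where \<open>S(X) = \<Prod>\<^bsub>s\<in>S\<^esub> (X - s)\<close> and \<open>\<Omega>(S) \<Omega>(S')\<close> depends only on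
  \<open>S \<inter> S'\<close> and \<open>S \<union> S'\<close>. Fixing these two sets in the bilinear expression reduces the claim to an
  identity for sums over the splittings \<open>D = A \<union> B\<close> of a set of \<open>2d\<close> points into halves. This sum is a
  polynomial of degree at most \<open>d + 1\<close> in each variable, and evaluating all four variables at points of
  \<open>D\<close> gives a multiple of the same sum for \<open>d - 2\<close>, so it follows by induction and interpolation.
\<close>

section \<open>Sums over splittings of a finite set of points\<close>

definition node_poly :: "nat set \<Rightarrow> 'f \<Rightarrow> 'f::field" where
  "node_poly A x = (\<Prod>a\<in>A. x - of_nat a)"

text \<open>The discriminant of \<open>node_poly A\<close>. The pairs are ordered by
  \<open>b < a\<close> only so that each unordered pair is counted once; the square removes the
  dependence on orientation.\<close>

definition sqdisc :: "nat set \<Rightarrow> 'f::field" where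
  "sqdisc A = (\<Prod>a\<in>A. \<Prod>b\<in>{b\<in>A. b < a}. (of_nat a - of_nat b)\<^sup>2)"

lemma node_poly_empty [simp]: "node_poly {} x = 1"
  by (simp add: node_poly_def)

lemma node_poly_insert:
  "finite A \<Longrightarrow> a \<notin> A \<Longrightarrow> node_poly (insert a A) x = (x - of_nat a) * node_poly A x"
  by (simp add: node_poly_def)

lemma node_poly_Un:
  "finite A \<Longrightarrow> finite B \<Longrightarrow> A \<inter> B = {} \<Longrightarrow> node_poly (A \<union> B) x = node_poly A x * node_poly B x"
  by (simp add: node_poly_def prod.union_disjoint)

lemma node_poly_eq_0: "finite A \<Longrightarrow> a \<in> A \<Longrightarrow> node_poly A (of_nat a) = 0"
  unfolding node_poly_def by (rule prod_zero) auto

lemma sqdisc_empty [simp]: "sqdisc {} = 1"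
  by (simp add: sqdisc_def)

text \<open>By symmetry of \<open>g\<close>, the pairs containing the new point can all be written
  \<open>g p b\<close>, whether \<open>b\<close> lies below or above \<open>p\<close>. Serves both
  the discriminant and the Vandermonde product.\<close>

lemma prod_pairs_insert:
  fixes g :: "nat \<Rightarrow> nat \<Rightarrow> 'a::comm_monoid_mult"
  assumes "finite A" "p \<notin> A" and sym: "\<And>a b. g a b = g b a"
  shows "(\<Prod>a\<in>insert p A. \<Prod>b\<in>{b\<in>insert p A. b < a}. g a b)
    = (\<Prod>a\<in>A. \<Prod>b\<in>{b\<in>A. b < a}. g a b) * (\<Prod>b\<in>A. g p b)"
proof -
  have fin: "finite {b\<in>A. Q b}" for Q using assms by simp
  have "(\<Prod>a\<in>A. \<Prod>b\<in>{b\<in>insert p A. b < a}. g a b)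
      = (\<Prod>a\<in>A. (if p < a then g p a else 1) * (\<Prod>b\<in>{b\<in>A. b < a}. g a b))"
  proof (rule prod.cong[OF refl])
    fix a assume "a \<in> A"
    show "(\<Prod>b\<in>{b\<in>insert p A. b < a}. g a b) = (if p < a then g p a else 1) * (\<Prod>b\<in>{b\<in>A. b < a}. g a b)"
    proof (cases "p < a")
      case True
      then have "{b\<in>insert p A. b < a} = insert p {b\<in>A. b < a}" by auto
      then show ?thesis using True assms(1,2) fin[of "\<lambda>b. b < a"] by (simp add: sym[of a p])
    next
      case False
      then have "{b\<in>insert p A. b < a} = {b\<in>A. b < a}" by auto
      then show ?thesis using False by simp
    qed
  qed
  also have "\<dots> = (\<Prod>a\<in>{a\<in>A. p < a}. g p a) * (\<Prod>a\<in>A. \<Prod>b\<in>{b\<in>A. b < a}. g a b)"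
    using assms(1) by (simp add: prod.distrib prod.If_cases Int_def)
  finally have 1: "(\<Prod>a\<in>A. \<Prod>b\<in>{b\<in>insert p A. b < a}. g a b)
      = (\<Prod>a\<in>{a\<in>A. p < a}. g p a) * (\<Prod>a\<in>A. \<Prod>b\<in>{b\<in>A. b < a}. g a b)" .
  have "{b\<in>insert p A. b < p} = {b\<in>A. b < p}" by auto
  moreover have "(\<Prod>b\<in>A. g p b) = (\<Prod>b\<in>{b\<in>A. b < p} \<union> {b\<in>A. p < b}. g p b)"
    using assms(2) by (intro prod.cong) (auto, metis linorder_neqE_nat)
  moreover have "\<dots> = (\<Prod>b\<in>{b\<in>A. b < p}. g p b) * (\<Prod>b\<in>{b\<in>A. p < b}. g p b)"
    by (rule prod.union_disjoint) (use assms in auto)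
  ultimately show ?thesis
    using assms(1,2) 1 by (simp add: mult_ac)
qed

lemma sqdisc_insert:
  assumes "finite A" "p \<notin> A"
  shows "sqdisc (insert p A) = sqdisc A * (node_poly A (of_nat p) :: 'f::field)\<^sup>2"
  unfolding sqdisc_def node_poly_def
  by (subst prod_pairs_insert[OF assms]) (simp_all add: power2_commute prod_power_distrib)

lemma sqdisc_singleton [simp]: "sqdisc {a} = 1"
  using sqdisc_insert[of "{}" a] by simp

lemma sqdisc_Un:
  assumes "finite A" "finite B" "A \<inter> B = {}"
  shows "(sqdisc (A \<union> B) :: 'f::field) = sqdisc A * sqdisc B * (\<Prod>b\<in>B. node_poly A (of_nat b))\<^sup>2"
  using assms(2,3)
proof (induction B rule: finite_induct)
  case (insert b B)
  have "(sqdisc (A \<union> insert b B) :: 'f) = sqdisc (A \<union> B) * (node_poly (A \<union> B) (of_nat b))\<^sup>2"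
    using insert assms by (simp add: sqdisc_insert)
  also have "\<dots> = sqdisc A * sqdisc (insert b B) * (\<Prod>b\<in>insert b B. node_poly A (of_nat b))\<^sup>2"
    using insert assms by (simp add: node_poly_Un sqdisc_insert power_mult_distrib mult_ac)
  finally show ?case .
qed simp

definition split_sum :: "nat set \<Rightarrow> nat \<Rightarrow> 'f \<Rightarrow> 'f \<Rightarrow> 'f \<Rightarrow> 'f \<Rightarrow> 'f::field" where
  "split_sum D d p q r s = (\<Sum>A | A \<subseteq> D \<and> card A = d. sqdisc A * sqdisc (D - A) *
     (node_poly A p * node_poly A q * node_poly (D - A) r * node_poly (D - A) s))"

definition fay_sum :: "nat set \<Rightarrow> nat \<Rightarrow> 'f \<Rightarrow> 'f \<Rightarrow> 'f \<Rightarrow> 'f \<Rightarrow> 'f::field" where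
  "fay_sum D d x1 x2 x3 x4 = (x1 - x2) * (x3 - x4) * split_sum D d x1 x2 x3 x4
     - (x1 - x3) * (x2 - x4) * split_sum D d x1 x3 x2 x4
     + (x1 - x4) * (x2 - x3) * split_sum D d x1 x4 x2 x3"

text \<open>Complementation is an involution on the halves, since
  \<open>card D = 2 * d\<close>.\<close>

lemma split_sum_swap:
  assumes "finite D" "card D = 2 * d"
  shows "split_sum D d p q r s = split_sum D d r s p q"
  unfolding split_sum_def
  by (rule sum.reindex_bij_witness[of _ "\<lambda>A. D - A" "\<lambda>A. D - A"])
    (use assms in \<open>auto simp: double_diff card_Diff_subset finite_subset mult_ac\<close>)

text \<open>The regrouping behind \<open>split_sum_reduce\<close>: \<open>QA\<close>,
  \<open>QB\<close> stand for the discriminants of the reduced halves, \<open>Ap\<close> to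
  \<open>Bs\<close> for their node polynomials at the four points, and \<open>u\<close>,
  \<open>v\<close>, \<open>w1\<close> to \<open>w4\<close> for the six differences of the
  points.\<close>

lemma split_sum_reduce_aux:
  fixes QA QB Ap Aq Ar As Bp Bq Br Bs u v w1 w2 w3 w4 :: "'f::comm_ring_1"
  shows "QA * As\<^sup>2 * (u * Ar)\<^sup>2 * (QB * Bq\<^sup>2 * (v * Bp)\<^sup>2)
      * (w1 * w2 * Ap * (w3 * w4 * Aq) * (w1 * w3 * Br) * (w2 * w4 * Bs))
    = (v * u * w1 * w2 * w3 * w4)\<^sup>2 * (Ap * Bp * (Aq * Bq) * (Ar * Br) * (As * Bs))
      * (QA * QB * (Ar * As * Bp * Bq))"
  by (simp add: power2_eq_square mult_ac)

text \<open>At nodes, a summand survives only if \<open>r\<close>, \<open>s\<close> lie in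
  \<open>A\<close> and \<open>p\<close>, \<open>q\<close> in its complement. Stripping these four
  points leaves the splittings of \<open>D'\<close> into halves of size \<open>d - 2\<close>. The
  prefactor is symmetric in the four points, which is what makes it common to all three Fay
  terms.\<close>

lemma split_sum_reduce:
  fixes p q r s :: nat and D :: "nat set"
  assumes D: "finite D" "card D = 2 * d" "d \<ge> 2"
    and mem: "p \<in> D" "q \<in> D" "r \<in> D" "s \<in> D" and dist: "distinct [p, q, r, s]"
  defines "D' \<equiv> D - {p, q, r, s}"
  shows "split_sum D d (of_nat p) (of_nat q) (of_nat r) (of_nat s)
    = ((of_nat p - of_nat q) * (of_nat r - of_nat s) * (of_nat p - of_nat r) * (of_nat p - of_nat s)
        * (of_nat q - of_nat r) * (of_nat q - of_nat s))\<^sup>2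
      * (node_poly D' (of_nat p) * node_poly D' (of_nat q) * node_poly D' (of_nat r) * node_poly D' (of_nat s))
      * (split_sum D' (d - 2) (of_nat p) (of_nat q) (of_nat r) (of_nat s) :: 'f::field)"
    (is "_ = ?K\<^sup>2 * ?N * _")
proof -
  have finD': "finite D'" using D by (simp add: D'_def)
  have cardD': "card D' = 2 * (d - 2)"
    using D mem dist by (simp add: D'_def card_Diff_subset)
  let ?w = "\<lambda>A. sqdisc A * sqdisc (D - A) * (node_poly A (of_nat p) * node_poly A (of_nat q)
     * node_poly (D - A) (of_nat r) * node_poly (D - A) (of_nat s)) :: 'f"
  let ?w' = "\<lambda>A. sqdisc A * sqdisc (D' - A) * (node_poly A (of_nat r) * node_poly A (of_nat s)
     * node_poly (D' - A) (of_nat p) * node_poly (D' - A) (of_nat q)) :: 'f"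
  have "(\<Sum>A | A \<subseteq> D \<and> card A = d. ?w A)
      = (\<Sum>A | A \<subseteq> D \<and> card A = d \<and> p \<notin> A \<and> q \<notin> A \<and> r \<in> A \<and> s \<in> A. ?w A)"
  proof (rule sum.mono_neutral_right)
    show "\<forall>A\<in>{A. A \<subseteq> D \<and> card A = d} - {A. A \<subseteq> D \<and> card A = d \<and> p \<notin> A \<and> q \<notin> A \<and> r \<in> A \<and> s \<in> A}.
        ?w A = 0"
    proof
      fix A assume "A \<in> {A. A \<subseteq> D \<and> card A = d} - {A. A \<subseteq> D \<and> card A = d \<and> p \<notin> A \<and> q \<notin> A \<and> r \<in> A \<and> s \<in> A}"
      then have "A \<subseteq> D" and *: "p \<in> A \<or> q \<in> A \<or> r \<in> D - A \<or> s \<in> D - A" using mem by auto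
      then have "finite A" "finite (D - A)" using D finite_subset by auto
      with * show "?w A = 0" by (auto simp: node_poly_eq_0)
    qed
  qed (use D in auto)
  also have "\<dots> = (\<Sum>A | A \<subseteq> D' \<and> card A = d - 2. ?K\<^sup>2 * ?N * ?w' A)"
  proof (rule sum.reindex_bij_witness[of _ "\<lambda>A. insert r (insert s A)" "\<lambda>A. A - {r, s}"])
    fix A assume "A \<in> {A. A \<subseteq> D' \<and> card A = d - 2}"
    then have A: "A \<subseteq> D'" "card A = d - 2" by auto
    then have finA: "finite A" using finD' finite_subset by auto
    have notin: "p \<notin> A" "q \<notin> A" "r \<notin> A" "s \<notin> A" using A(1) by (auto simp: D'_def)
    show "insert r (insert s A) - {r, s} = A" using notin by auto
    show "insert r (insert s A) \<in> {A. A \<subseteq> D \<and> card A = d \<and> p \<notin> A \<and> q \<notin> A \<and> r \<in> A \<and> s \<in> A}"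
      using A notin dist mem D finA by (auto simp: D'_def)
  next
    fix A assume "A \<in> {A. A \<subseteq> D \<and> card A = d \<and> p \<notin> A \<and> q \<notin> A \<and> r \<in> A \<and> s \<in> A}"
    then have A: "A \<subseteq> D" "card A = d" "p \<notin> A" "q \<notin> A" "r \<in> A" "s \<in> A" by auto
    then have finA: "finite A" using D finite_subset by auto
    define A' where "A' = A - {r, s}"
    define B' where "B' = D' - A'"
    have Aeq: "A = insert r (insert s A')" using A by (auto simp: A'_def)
    have Beq: "D - A = insert p (insert q B')"
      using A mem by (auto simp: A'_def B'_def D'_def)
    have fin: "finite A'" "finite B'" using finA finD' by (auto simp: A'_def B'_def)
    have notin: "r \<notin> A'" "s \<notin> A'" "p \<notin> B'" "q \<notin> B'" by (auto simp: A'_def B'_def D'_def)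
    have "A' \<subseteq> D'" using A by (auto simp: A'_def D'_def)
    then have D'eq: "D' = A' \<union> B'" "A' \<inter> B' = {}" by (auto simp: B'_def)
    have N: "node_poly D' x = node_poly A' x * node_poly B' x" for x :: 'f
      unfolding D'eq(1) using fin D'eq(2) by (rule node_poly_Un)
    show "insert r (insert s (A - {r, s})) = A" using A by auto
    show "A - {r, s} \<in> {A. A \<subseteq> D' \<and> card A = d - 2}"
      using A finA dist \<open>A' \<subseteq> D'\<close> by (auto simp: A'_def card_Diff_subset)
    show "?K\<^sup>2 * ?N * ?w' (A - {r, s}) = ?w A"
    proof -
      \<comment> \<open>Both linear factors are reversed, so the signs cancel; this orientation
        yields the same differences as in \<open>NA\<close>.\<close>
      have NB: "node_poly (D - A) x = (of_nat p - x) * (of_nat q - x) * node_poly B' x" for x :: 'f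
        unfolding Beq using fin notin dist by (simp add: node_poly_insert algebra_simps)
      have NA: "node_poly A x = (x - of_nat r) * (x - of_nat s) * node_poly A' x" for x :: 'f
        unfolding Aeq using fin notin dist by (simp add: node_poly_insert)
      have "sqdisc A = (sqdisc A' * (node_poly A' (of_nat s))\<^sup>2
          * ((of_nat r - of_nat s) * node_poly A' (of_nat r))\<^sup>2 :: 'f)"
        unfolding Aeq using fin notin dist by (simp add: sqdisc_insert node_poly_insert)
      moreover have "sqdisc (D - A) = (sqdisc B' * (node_poly B' (of_nat q))\<^sup>2
          * ((of_nat p - of_nat q) * node_poly B' (of_nat p))\<^sup>2 :: 'f)"
        unfolding Beq using fin notin dist by (simp add: sqdisc_insert node_poly_insert)
      ultimately show ?thesis
        unfolding A'_def[symmetric] B'_def[symmetric] NA NB N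
        by (simp only: split_sum_reduce_aux)
    qed
  qed
  \<comment> \<open>Of the squared factors \<open>node_poly A'\<close> at \<open>r\<close>,
    \<open>s\<close> and \<open>node_poly B'\<close> at \<open>p\<close>, \<open>q\<close> in the
    discriminants, one power completes \<open>?N\<close> and the other remains. The two pairs of
    arguments have thus changed sides, and \<open>split_sum_swap\<close> restores them.\<close>
  also have "\<dots> = ?K\<^sup>2 * ?N * split_sum D' (d - 2) (of_nat r) (of_nat s) (of_nat p) (of_nat q)"
    by (simp add: split_sum_def sum_distrib_left)
  finally show ?thesis
    unfolding split_sum_def[of D] split_sum_swap[OF finD' cardD', of "of_nat p"] .
qed

section \<open>Polynomial functions of bounded degree\<close>

definition is_polyfun :: "nat \<Rightarrow> ('f \<Rightarrow> 'f::field) \<Rightarrow> bool" where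
  "is_polyfun n f \<longleftrightarrow> (\<exists>P. degree P \<le> n \<and> (\<forall>x. f x = poly P x))"

lemma is_polyfun_const: "is_polyfun 0 (\<lambda>_. c)"
  unfolding is_polyfun_def by (rule exI[of _ "[:c:]"]) simp

lemma is_polyfun_affine: "is_polyfun 1 (\<lambda>x. x - c)" "is_polyfun 1 (\<lambda>x. c - x)"
  unfolding is_polyfun_def by (rule exI[of _ "[:-c, 1:]"], simp) (rule exI[of _ "[:c, -1:]"], simp)

lemma is_polyfun_mult:
  "is_polyfun m f \<Longrightarrow> is_polyfun n g \<Longrightarrow> k = m + n \<Longrightarrow> is_polyfun k (\<lambda>x. f x * g x)"
  unfolding is_polyfun_def by (metis poly_mult add_mono degree_mult_le order_trans)

lemma is_polyfun_cmult:
  "is_polyfun n f \<Longrightarrow> is_polyfun n (\<lambda>x. c * f x)" "is_polyfun n f \<Longrightarrow> is_polyfun n (\<lambda>x. f x * c)"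
  by (simp_all add: is_polyfun_mult[OF is_polyfun_const] is_polyfun_mult[OF _ is_polyfun_const])

lemma is_polyfun_add: "is_polyfun n f \<Longrightarrow> is_polyfun n g \<Longrightarrow> is_polyfun n (\<lambda>x. f x + g x)"
  unfolding is_polyfun_def by (metis poly_add degree_add_le)

lemma is_polyfun_diff: "is_polyfun n f \<Longrightarrow> is_polyfun n g \<Longrightarrow> is_polyfun n (\<lambda>x. f x - g x)"
  unfolding is_polyfun_def by (metis poly_diff degree_diff_le)

lemma is_polyfun_sum:
  "(\<And>i. i \<in> I \<Longrightarrow> is_polyfun n (f i)) \<Longrightarrow> is_polyfun n (\<lambda>x. \<Sum>i\<in>I. f i x)"
proof (induction I rule: infinite_finite_induct)
  case (insert i I)
  then show ?case by (auto intro: is_polyfun_add)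
qed (auto simp: is_polyfun_def intro: exI[of _ 0])

lemma is_polyfun_node_poly: "finite A \<Longrightarrow> card A = n \<Longrightarrow> is_polyfun n (node_poly A :: 'f \<Rightarrow> 'f::field)"
proof (induction A arbitrary: n rule: finite_induct)
  case (insert a A)
  then have "is_polyfun n (\<lambda>x :: 'f. (x - of_nat a) * node_poly A x)"
    by (intro is_polyfun_mult[OF is_polyfun_affine(1)]) auto
  then show ?case using insert by (simp add: node_poly_insert)
qed (use is_polyfun_const[of "1::'f"] in \<open>simp add: node_poly_def[abs_def]\<close>)

lemma is_polyfun_eq_0:
  assumes "is_polyfun n f" "\<And>z. z \<in> Z \<Longrightarrow> f z = 0" "n < card Z"
  shows "f x = 0"
proof -
  obtain P where P: "degree P \<le> n" "\<And>x. f x = poly P x"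
    using assms(1) unfolding is_polyfun_def by blast
  have "P = 0"
  proof (rule ccontr)
    assume "P \<noteq> 0"
    then have "card Z \<le> card {x. poly P x = 0}"
      using assms(2) P(2) by (intro card_mono poly_roots_finite) auto
    with card_poly_roots_bound[OF \<open>P \<noteq> 0\<close>] P(1) assms(3) show False by simp
  qed
  then show ?thesis using P(2) by simp
qed

text \<open>Each argument enters a summand through exactly one node polynomial, that of a set with
  \<open>d\<close> elements.\<close>

lemma is_polyfun_split_sum:
  assumes "finite D" "card D = 2 * d"
  shows "is_polyfun d (\<lambda>x. split_sum D d x q r s)" "is_polyfun d (\<lambda>x. split_sum D d q x r s)"
    "is_polyfun d (\<lambda>x. split_sum D d q r x s)" "is_polyfun d (\<lambda>x. split_sum D d q r s x)"
  unfolding split_sum_def using assms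
  by (auto intro!: is_polyfun_sum is_polyfun_cmult is_polyfun_node_poly finite_subset[of _ D]
      simp: card_Diff_subset finite_subset)

text \<open>In each of the three terms a given variable occurs in just one of the two linear
  prefactors, which raises the degree bound of \<open>split_sum\<close> by one.\<close>

lemma is_polyfun_fay_sum:
  assumes "finite D" "card D = 2 * d"
  shows "is_polyfun (1 + d) (\<lambda>x. fay_sum D d x q r s)" "is_polyfun (1 + d) (\<lambda>x. fay_sum D d q x r s)"
    "is_polyfun (1 + d) (\<lambda>x. fay_sum D d q r x s)" "is_polyfun (1 + d) (\<lambda>x. fay_sum D d q r s x)"
  unfolding fay_sum_def
  by (intro is_polyfun_add is_polyfun_diff is_polyfun_mult[OF _ is_polyfun_split_sum(1)[OF assms] refl]
      is_polyfun_mult[OF _ is_polyfun_split_sum(2)[OF assms] refl]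
      is_polyfun_mult[OF _ is_polyfun_split_sum(3)[OF assms] refl]
      is_polyfun_mult[OF _ is_polyfun_split_sum(4)[OF assms] refl] is_polyfun_cmult is_polyfun_affine)+

section \<open>Vanishing of the Fay sum by induction and interpolation\<close>

text \<open>\<open>split_sum_reduce\<close> extracts the same factor from all three terms, so the
  Fay sum at four nodes is a multiple of the one for the remaining nodes.\<close>

lemma fay_sum_reduce:
  fixes p q r s :: nat and D :: "nat set"
  assumes D: "finite D" "card D = 2 * d" "d \<ge> 2"
    and mem: "p \<in> D" "q \<in> D" "r \<in> D" "s \<in> D" and dist: "distinct [p, q, r, s]"
    and zero: "fay_sum (D - {p, q, r, s}) (d - 2) (of_nat p) (of_nat q) (of_nat r) (of_nat s) = (0::'f)"
  shows "fay_sum D d (of_nat p) (of_nat q) (of_nat r) (of_nat s) = (0::'f::field)"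
proof -
  define K :: 'f where "K = ((of_nat p - of_nat q) * (of_nat r - of_nat s) * (of_nat p - of_nat r)
    * (of_nat p - of_nat s) * (of_nat q - of_nat r) * (of_nat q - of_nat s))\<^sup>2"
  \<comment> \<open>Permuting the points only reorders the differences and reverses some of them;
    the square absorbs the signs.\<close>
  have K: "K = ((of_nat p - of_nat r) * (of_nat q - of_nat s) * (of_nat p - of_nat q) * (of_nat p - of_nat s)
        * (of_nat r - of_nat q) * (of_nat r - of_nat s))\<^sup>2"
      "K = ((of_nat p - of_nat s) * (of_nat q - of_nat r) * (of_nat p - of_nat q) * (of_nat p - of_nat r)
        * (of_nat s - of_nat q) * (of_nat s - of_nat r))\<^sup>2"
    unfolding K_def power_mult_distrib
    by (simp_all only: power2_commute[of "of_nat r :: 'f" "of_nat q"] power2_commute[of "of_nat s :: 'f" "of_nat q"]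
        power2_commute[of "of_nat s :: 'f" "of_nat r"] mult_ac)
  have dist': "distinct [p, r, q, s]" "distinct [p, s, q, r]" using dist by auto
  have D': "D - {p, r, q, s} = D - {p, q, r, s}" "D - {p, s, q, r} = D - {p, q, r, s}" by auto
  let ?N = "\<lambda>x. node_poly (D - {p, q, r, s}) (of_nat x :: 'f)"
  have N: "?N p * ?N r * ?N q * ?N s = ?N p * ?N q * ?N r * ?N s"
    "?N p * ?N s * ?N q * ?N r = ?N p * ?N q * ?N r * ?N s" by simp_all
  let ?S = "\<lambda>x y z w. split_sum (D - {p, q, r, s}) (d - 2) (of_nat x) (of_nat y) (of_nat z) (of_nat w :: 'f)"
  have "split_sum D d (of_nat p) (of_nat q) (of_nat r) (of_nat s)
      = K * (?N p * ?N q * ?N r * ?N s) * ?S p q r s"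
    unfolding K_def by (rule split_sum_reduce[OF D mem dist])
  moreover have "split_sum D d (of_nat p) (of_nat r) (of_nat q) (of_nat s)
      = K * (?N p * ?N r * ?N q * ?N s) * ?S p r q s"
    unfolding K(1) D'(1)[symmetric] by (rule split_sum_reduce[OF D mem(1,3,2,4) dist'(1)])
  moreover have "split_sum D d (of_nat p) (of_nat s) (of_nat q) (of_nat r)
      = K * (?N p * ?N s * ?N q * ?N r) * ?S p s q r"
    unfolding K(2) D'(2)[symmetric] by (rule split_sum_reduce[OF D mem(1,4,2,3) dist'(2)])
  moreover have "u * (L * S1) - v * (L * S2) + w * (L * S3) = L * (u * S1 - v * S2 + w * S3)"
    for u v w L S1 S2 S3 :: 'f
    by (simp add: algebra_simps)
  ultimately have "fay_sum D d (of_nat p) (of_nat q) (of_nat r) (of_nat s)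
      = K * (?N p * ?N q * ?N r * ?N s)
        * fay_sum (D - {p, q, r, s}) (d - 2) (of_nat p) (of_nat q) (of_nat r) (of_nat s)"
    unfolding fay_sum_def by (simp only: N)
  with zero show ?thesis by simp
qed

text \<open>Take two coinciding arguments. In a term where they belong to the same half, the linear
  prefactor is 0. In a term where they belong to opposite halves, the common node is a root of one
  of the two node polynomials.\<close>

lemma fay_sum_not_distinct:
  fixes p q r s :: nat and D :: "nat set"
  assumes D: "finite D" and mem: "p \<in> D" "q \<in> D" "r \<in> D" "s \<in> D" and "\<not> distinct [p, q, r, s]"
  shows "fay_sum D d (of_nat p) (of_nat q) (of_nat r) (of_nat s) = (0::'f::field)"
proof -
  have 0: "node_poly A (of_nat x) = (0::'f) \<or> node_poly (D - A) (of_nat x) = (0::'f)" if "A \<subseteq> D" "x \<in> D" for A x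
    using that D node_poly_eq_0[of A x] node_poly_eq_0[of "D - A" x] by (cases "x \<in> A") (auto simp: finite_subset)
  have S1: "split_sum D d (of_nat x) y (of_nat x) z = (0::'f)"
    "split_sum D d (of_nat x) y z (of_nat x) = (0::'f)"
    "split_sum D d y (of_nat x) (of_nat x) z = (0::'f)"
    "split_sum D d y (of_nat x) z (of_nat x) = (0::'f)" if "x \<in> D" for x y z
    unfolding split_sum_def
    by (rule sum.neutral, clarify, drule 0[OF _ that], erule disjE, simp, simp)+
  from assms(6) consider "p = q" | "p = r" | "p = s" | "q = r" | "q = s" | "r = s" by auto
  then show ?thesis
    by cases (use mem in \<open>simp_all add: fay_sum_def S1\<close>)
qed

text \<open>Induction in steps of two. At four nodes the claim follows from the case
  \<open>d - 2\<close> or from a coincidence, and the degree bound \<open>d + 1\<close> is below the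
  number \<open>2 * d\<close> of nodes once \<open>d \<ge> 2\<close>.\<close>

lemma fay_sum_eq_0:
  assumes "finite D" "card D = 2 * d"
  shows "fay_sum D d x1 x2 x3 x4 = (0::'f::field_char_0)"
  using assms
proof (induction d arbitrary: D x1 x2 x3 x4 rule: less_induct)
  case (less d)
  consider "d = 0" | "d = 1" | "d \<ge> 2" by linarith
  then show ?case
  proof cases
    case 1
    then have "D = {}" using less by auto
    then have "{A. A \<subseteq> D \<and> card A = d} = {{}}" using 1 by auto
    \<comment> \<open>Only the three products of differences remain; this is the Pluecker
      relation.\<close>
    then show ?thesis unfolding fay_sum_def split_sum_def using \<open>D = {}\<close> by (simp add: algebra_simps)
  next
    case 2
    then obtain p q where D: "D = {p, q}" "p \<noteq> q" using less by (auto simp: card_2_iff)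
    then have *: "{A. A \<subseteq> D \<and> card A = d} = {{p}, {q}}"
      using 2 by (auto simp: card_1_singleton_iff)
    have D': "D - {p} = {q}" "D - {q} = {p}" using D by auto
    have split: "split_sum D d x y z w = (x - of_nat p) * (y - of_nat p) * (z - of_nat q) * (w - of_nat q)
        + (x - of_nat q) * (y - of_nat q) * (z - of_nat p) * (w - of_nat p :: 'f)" for x y z w
      unfolding split_sum_def * using D(2) by (simp add: D' node_poly_def)
    show ?thesis unfolding fay_sum_def split by algebra
  next
    case 3
    define Z where "Z = (of_nat ` D :: 'f set)"
    \<comment> \<open>Characteristic 0 keeps the nodes distinct in the field.\<close>
    have "card Z = 2 * d" unfolding Z_def using less(3) by (simp add: card_image inj_on_def)
    then have cardZ: "1 + d < card Z" using 3 by simp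
    have base: "fay_sum D d x1 x2 x3 x4 = 0" if "x1 \<in> Z" "x2 \<in> Z" "x3 \<in> Z" "x4 \<in> Z" for x1 x2 x3 x4
    proof -
      from that obtain p q r s where pqrs: "x1 = of_nat p" "x2 = of_nat q" "x3 = of_nat r" "x4 = of_nat s"
        and mem: "p \<in> D" "q \<in> D" "r \<in> D" "s \<in> D" unfolding Z_def by blast
      show ?thesis
      proof (cases "distinct [p, q, r, s]")
        case True
        have "card (D - {p, q, r, s}) = 2 * (d - 2)"
          using less mem True by (simp add: card_Diff_subset)
        then have "fay_sum (D - {p, q, r, s}) (d - 2) (of_nat p) (of_nat q) (of_nat r) (of_nat s) = (0::'f)"
          using less 3 by (intro less.IH) auto
        then show ?thesis
          unfolding pqrs by (rule fay_sum_reduce[OF less(2,3) 3 mem True])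
      next
        case False
        then show ?thesis unfolding pqrs by (rule fay_sum_not_distinct[OF less(2) mem])
      qed
    qed
    note pf = is_polyfun_fay_sum[OF less(2,3)]
    \<comment> \<open>The variables are freed from \<open>Z\<close> one at a time, the last one
      first.\<close>
    have 3: "fay_sum D d x1 x2 x3 x4 = 0" if "x1 \<in> Z" "x2 \<in> Z" "x3 \<in> Z" for x1 x2 x3 x4
      using is_polyfun_eq_0[OF pf(4) base[OF that] cardZ] .
    have 2: "fay_sum D d x1 x2 x3 x4 = 0" if "x1 \<in> Z" "x2 \<in> Z" for x1 x2 x3 x4
      using is_polyfun_eq_0[OF pf(3) 3[OF that] cardZ] .
    have 1: "fay_sum D d x1 x2 x3 x4 = 0" if "x1 \<in> Z" for x1 x2 x3 x4
      using is_polyfun_eq_0[OF pf(2) 2[OF that] cardZ] .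
    show ?thesis using is_polyfun_eq_0[OF pf(1) 1 cardZ] .
  qed
qed

section \<open>The three-term relation for sums over subsets\<close>

text \<open>The contribution of a pair of subsets to the bilinear expression, apart from the
  weights. The two subsets may overlap, unlike the halves in \<open>fay_sum\<close>.\<close>

definition fay_bracket :: "nat set \<Rightarrow> nat set \<Rightarrow> 'f \<Rightarrow> 'f \<Rightarrow> 'f \<Rightarrow> 'f \<Rightarrow> 'f::field" where
  "fay_bracket A B x1 x2 x3 x4 = sqdisc A * sqdisc B *
     ((x1 - x2) * (x3 - x4) * (node_poly A x1 * node_poly A x2 * node_poly B x3 * node_poly B x4)
    - (x1 - x3) * (x2 - x4) * (node_poly A x1 * node_poly A x3 * node_poly B x2 * node_poly B x4)
    + (x1 - x4) * (x2 - x3) * (node_poly A x1 * node_poly A x4 * node_poly B x2 * node_poly B x3))"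

lemma sum_fay_bracket_complement:
  "(\<Sum>A | A \<subseteq> D \<and> card A = d. fay_bracket A (D - A) x1 x2 x3 x4) = fay_sum D d x1 x2 x3 x4"
  unfolding fay_sum_def split_sum_def sum_distrib_left sum_subtractf[symmetric] sum.distrib[symmetric]
  by (rule sum.cong) (simp_all add: fay_bracket_def algebra_simps)

text \<open>Each variable occurs once in each of the three terms, so the common part
  \<open>I\<close> contributes the same four values there. The discriminants supply the interaction
  of \<open>I\<close> with \<open>A\<close> and with \<open>B\<close>, which depends only on
  \<open>A \<union> B\<close>.\<close>

lemma fay_bracket_Un:
  assumes "finite I" "finite A" "finite B" "I \<inter> A = {}" "I \<inter> B = {}" "A \<inter> B = {}"
  shows "fay_bracket (I \<union> A) (I \<union> B) x1 x2 x3 x4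
    = (sqdisc I * (\<Prod>b\<in>A \<union> B. node_poly I (of_nat b)))\<^sup>2
      * (node_poly I x1 * node_poly I x2 * node_poly I x3 * node_poly I x4)
      * (fay_bracket A B x1 x2 x3 x4 :: 'f::field)"
proof -
  have alg: "(Q * QA * PA\<^sup>2) * (Q * QB * PB\<^sup>2) *
     (u * (i1 * a1 * (i2 * a2) * (i3 * b3) * (i4 * b4)) - v * (i1 * a1 * (i3 * a3) * (i2 * b2) * (i4 * b4))
       + w * (i1 * a1 * (i4 * a4) * (i2 * b2) * (i3 * b3)))
    = (Q * (PA * PB))\<^sup>2 * (i1 * i2 * i3 * i4) * (QA * QB *
     (u * (a1 * a2 * b3 * b4) - v * (a1 * a3 * b2 * b4) + w * (a1 * a4 * b2 * b3)))"
    for Q QA PA QB PB u v w i1 i2 i3 i4 a1 a2 a3 a4 b2 b3 b4 :: 'f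
    by (simp add: algebra_simps power2_eq_square)
  show ?thesis
    unfolding fay_bracket_def using assms
    by (simp only: node_poly_Un sqdisc_Un prod.union_disjoint alg)
qed

text \<open>Once the common factor from \<open>I\<close> is removed, the pairs with intersection
  \<open>I\<close> and union \<open>J\<close> are the splittings of \<open>J - I\<close> into
  halves, and the sum becomes a multiple of \<open>fay_sum\<close>.\<close>

lemma sum_fay_bracket_fibre:
  fixes x1 x2 x3 x4 :: "'f::field_char_0"
  assumes J: "finite J"
  shows "(\<Sum>(S, S') | card S = M \<and> card S' = M \<and> S \<inter> S' = I \<and> S \<union> S' = J.
    fay_bracket S S' x1 x2 x3 x4) = 0"
proof (cases "{(S, S'). card S = M \<and> card S' = M \<and> S \<inter> S' = I \<and> S \<union> S' = J} = {}")
  case False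
  then obtain S S' where S: "card S = M" "card S' = M" "S \<inter> S' = I" "S \<union> S' = J" by auto
  then have fin: "finite S" "finite S'" "finite I" using J by (auto simp: finite_subset)
  define D d where "D = J - I" and "d = M - card I"
  have IJ: "I \<subseteq> J" using S by auto
  \<comment> \<open>Inclusion-exclusion for the chosen pair of the nonempty fibre; it shows that
    \<open>D\<close> has exactly \<open>2 * d\<close> elements.\<close>
  have "card I + card J = 2 * M" using card_Un_Int[OF fin(1,2)] S by simp
  moreover have "card I \<le> M" using S fin by (metis card_mono Int_lower1)
  moreover have "card D = card J - card I" unfolding D_def using IJ fin by (simp add: card_Diff_subset)
  ultimately have D: "finite D" "card D = 2 * d" "M = card I + d"
    using J by (auto simp: D_def d_def)
  let ?K = "(sqdisc I * (\<Prod>b\<in>D. node_poly I (of_nat b)))\<^sup>2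
      * (node_poly I x1 * node_poly I x2 * node_poly I x3 * node_poly I x4)"
  have "(\<Sum>(S, S') | card S = M \<and> card S' = M \<and> S \<inter> S' = I \<and> S \<union> S' = J. fay_bracket S S' x1 x2 x3 x4)
      = (\<Sum>A | A \<subseteq> D \<and> card A = d. ?K * fay_bracket A (D - A) x1 x2 x3 x4)"
  proof (rule sum.reindex_bij_witness[of _ "\<lambda>A. (I \<union> A, I \<union> (D - A))" "\<lambda>(S, S'). S - I"], goal_cases)
    case (1 SS)
    then show ?case by (auto simp: D_def)
  next
    case (2 SS)
    then have "finite (fst SS)" using J by (auto intro: finite_subset)
    then show ?case using 2 D(3) fin by (auto simp: D_def card_Diff_subset)
  next
    case (3 A)
    then show ?case by (auto simp: D_def)
  next
    case (4 A)
    then have A: "finite A" "A \<inter> I = {}" "card (D - A) = d" 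
      using D by (auto simp: D_def finite_subset card_Diff_subset)
    then have "card (I \<union> A) = M" "card (I \<union> (D - A)) = M"
      using 4 D fin by (subst card_Un_disjoint; auto simp: D_def)+
    then show ?case using 4 IJ by (auto simp: D_def)
  next
    case (5 SS)
    then obtain S S' where SS: "SS = (S, S')" "S \<inter> S' = I" "S \<union> S' = J" by auto
    have eq: "S = I \<union> (S - I)" "S' = I \<union> (D - (S - I))" using SS by (auto simp: D_def)
    have DU: "(S - I) \<union> (D - (S - I)) = D" using SS by (auto simp: D_def)
    have "fay_bracket (I \<union> (S - I)) (I \<union> (D - (S - I))) x1 x2 x3 x4
      = ?K * fay_bracket (S - I) (D - (S - I)) x1 x2 x3 x4"
      by (subst fay_bracket_Un, unfold DU) (use SS J D fin in \<open>auto simp: D_def intro: finite_subset\<close>)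
    then show ?case using SS(1) eq by simp
  qed
  also have "\<dots> = ?K * fay_sum D d x1 x2 x3 x4"
    by (simp only: sum_distrib_left[symmetric] sum_fay_bracket_complement)
  finally show ?thesis using fay_sum_eq_0[OF D(1,2), of x1 x2 x3 x4] by simp
next
  case True
  then show ?thesis by (simp only: sum.empty)
qed

text \<open>The products are expanded over pairs of subsets and grouped by intersection and union.
  On each group the weight is constant, so the group sum vanishes by the fibre lemma. The weights
  live in a ring \<open>'r\<close> of their own so that they can be power series, with
  \<open>c\<close> the embedding of scalars.\<close>

lemma three_term_subsets:
  fixes Om :: "nat set \<Rightarrow> 'r::comm_ring_1" and c :: "'f::field_char_0 \<Rightarrow> 'r"
  assumes P: "finite P"
    and c_add: "\<And>x y. c (x + y) = c x + c y" and c_mult: "\<And>x y. c (x * y) = c x * c y"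
    and Om: "\<And>S S' U U'. {S, S', U, U'} \<subseteq> {S. S \<subseteq> P \<and> card S = M} \<Longrightarrow> S \<inter> S' = U \<inter> U' \<Longrightarrow> S \<union> S' = U \<union> U'
      \<Longrightarrow> Om S * Om S' = Om U * Om U'"
  defines "F \<equiv> \<lambda>x y. \<Sum>S | S \<subseteq> P \<and> card S = M. Om S * c (sqdisc S * (node_poly S x * node_poly S y))"
  shows "c ((x1 - x2) * (x3 - x4)) * F x1 x2 * F x3 x4 - c ((x1 - x3) * (x2 - x4)) * F x1 x3 * F x2 x4
    + c ((x1 - x4) * (x2 - x3)) * F x1 x4 * F x2 x3 = 0"
proof -
  define C where "C = {S. S \<subseteq> P \<and> card S = M}"
  have finC: "finite C" unfolding C_def using P by simp
  have c0: "c 0 = 0" using c_add[of 0 0] by simp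
  have c_diff: "c (x - y) = c x - c y" for x y using c_add[of "x - y" y] by simp
  have c_sum: "c (sum h A) = (\<Sum>a\<in>A. c (h a))" for h and A :: "(nat set \<times> nat set) set"
    by (induction A rule: infinite_finite_induct) (simp_all add: c0 c_add)
  let ?T = "\<lambda>(S, S'). Om S * Om S' * c (fay_bracket S S' x1 x2 x3 x4)"
  have prod: "c k * F x y * F z w = (\<Sum>(S, S')\<in>C \<times> C. c k * (Om S * c (sqdisc S * (node_poly S x * node_poly S y)))
      * (Om S' * c (sqdisc S' * (node_poly S' z * node_poly S' w))))" for k x y z w
    unfolding F_def C_def[symmetric]
    by (simp only: sum_distrib_left[of "c k"] sum_product sum.cartesian_product)
  have "c ((x1 - x2) * (x3 - x4)) * F x1 x2 * F x3 x4 - c ((x1 - x3) * (x2 - x4)) * F x1 x3 * F x2 x4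
    + c ((x1 - x4) * (x2 - x3)) * F x1 x4 * F x2 x3 = (\<Sum>SS\<in>C \<times> C. ?T SS)"
    unfolding prod sum_subtractf[symmetric] sum.distrib[symmetric]
    by (rule sum.cong) (auto simp: fay_bracket_def c_mult c_add c_diff algebra_simps)
  also have "\<dots> = (\<Sum>IJ\<in>(\<lambda>(S, S'). (S \<inter> S', S \<union> S')) ` (C \<times> C).
      \<Sum>SS | SS \<in> C \<times> C \<and> (case SS of (S, S') \<Rightarrow> (S \<inter> S', S \<union> S')) = IJ. ?T SS)"
    by (rule sum.group[symmetric]) (use finC in auto)
  also have "\<dots> = 0"
  proof (rule sum.neutral, intro ballI)
    fix IJ assume "IJ \<in> (\<lambda>(S, S'). (S \<inter> S', S \<union> S')) ` (C \<times> C)"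
    then obtain U U' where U: "U \<in> C" "U' \<in> C" and IJ: "IJ = (U \<inter> U', U \<union> U')" by auto
    \<comment> \<open>Containment in \<open>P\<close> need not be repeated on the right: both sets
      lie in \<open>U \<union> U'\<close>.\<close>
    have fib: "{SS. SS \<in> C \<times> C \<and> (case SS of (S, S') \<Rightarrow> (S \<inter> S', S \<union> S')) = (U \<inter> U', U \<union> U')}
      = {(S, S'). card S = M \<and> card S' = M \<and> S \<inter> S' = U \<inter> U' \<and> S \<union> S' = U \<union> U'}"
      using U unfolding C_def by auto
    have "(\<Sum>SS | SS \<in> C \<times> C \<and> (case SS of (S, S') \<Rightarrow> (S \<inter> S', S \<union> S')) = (U \<inter> U', U \<union> U'). ?T SS)
      = (\<Sum>SS | SS \<in> C \<times> C \<and> (case SS of (S, S') \<Rightarrow> (S \<inter> S', S \<union> S')) = (U \<inter> U', U \<union> U').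
          Om U * Om U' * c (case SS of (S, S') \<Rightarrow> fay_bracket S S' x1 x2 x3 x4))"
    proof (rule sum.cong[OF refl], clarify)
      fix S S' assume "S \<in> C" "S' \<in> C" "S \<inter> S' = U \<inter> U'" "S \<union> S' = U \<union> U'"
      then have "Om S * Om S' = Om U * Om U'" using U by (intro Om) (auto simp: C_def)
      then show "Om S * Om S' * c (fay_bracket S S' x1 x2 x3 x4) = Om U * Om U' * c (fay_bracket S S' x1 x2 x3 x4)"
        by simp
    qed
    also have "\<dots> = Om U * Om U' * c (\<Sum>(S, S') | card S = M \<and> card S' = M \<and> S \<inter> S' = U \<inter> U' \<and> S \<union> S' = U \<union> U'.
        fay_bracket S S' x1 x2 x3 x4)"
      unfolding fib c_sum sum_distrib_left ..
    also have "\<dots> = 0"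
      using U P by (subst sum_fay_bracket_fibre) (auto simp: C_def c0 intro: finite_subset)
    finally show "(\<Sum>SS | SS \<in> C \<times> C \<and> (case SS of (S, S') \<Rightarrow> (S \<inter> S', S \<union> S')) = IJ. ?T SS) = 0"
      unfolding IJ .
  qed
  finally show ?thesis .
qed

section \<open>Formal power series\<close>

lemma mps_coeff_add [simp]: "mps_coeff (f + g) m = mps_coeff f m + mps_coeff g m"
  by (simp add: plus_mps.rep_eq)
lemma mps_coeff_diff [simp]: "mps_coeff (f - g) m = mps_coeff f m - mps_coeff g m"
  by (simp add: minus_mps.rep_eq)
lemma mps_coeff_0 [simp]: "mps_coeff 0 m = 0"
  by (simp add: zero_mps.rep_eq)
lemma mps_coeff_sum: "mps_coeff (\<Sum>i\<in>I. f i) m = (\<Sum>i\<in>I. mps_coeff (f i) m)"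
  by (induction I rule: infinite_finite_induct) simp_all

lemma mps_coeff_const_mult:
  fixes f :: "('v, 'a::comm_ring_1) mps"
  shows "mps_coeff (mps_const c * f) m = c * mps_coeff f m"
proof -
  have "mps_coeff (mps_const c * f) m
      = (\<Sum>(a, b)\<in>{(0 :: 'v \<Rightarrow>\<^sub>0 nat, m)}. mps_coeff (mps_const c) a * mps_coeff f b)"
    unfolding mps_coeff_mult using finite_decompositions[of m]
    by (intro sum.mono_neutral_right) (auto simp: mps_coeff_const split: if_splits)
  then show ?thesis by (simp add: mps_coeff_const)
qed

lemma mps_const_add: "mps_const (x + y) = mps_const x + mps_const (y :: 'a::comm_ring_1)"
  by (rule mps_eqI) (simp add: mps_coeff_const)

lemma mps_const_0: "mps_const 0 = 0"
  by (rule mps_eqI) (simp add: mps_coeff_const)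

lemma mps_const_1: "mps_const 1 = (1 :: ('v, 'a::comm_ring_1) mps)"
  by (rule mps_eqI) (simp add: mps_coeff_const one_mps.rep_eq)

lemma mps_const_mult: "mps_const (x * y) = mps_const x * mps_const (y :: 'a::comm_ring_1)"
  by (rule mps_eqI) (simp add: mps_coeff_const_mult mps_coeff_const)

section \<open>Congruence of power series up to a given weight\<close>

text \<open>The weight is a parameter because two are used: the total degree for the exponential
  law, and the exponent of \<open>LambdaSq\<close> for the partition function.\<close>

definition mps_cong :: "(('v \<Rightarrow>\<^sub>0 nat) \<Rightarrow> nat) \<Rightarrow> nat \<Rightarrow> ('v, 'a) mps \<Rightarrow> ('v, 'a) mps \<Rightarrow> bool" where
  "mps_cong wt N f g \<longleftrightarrow> (\<forall>m. wt m \<le> N \<longrightarrow> mps_coeff f m = mps_coeff g m)"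

lemma mps_cong_refl: "mps_cong wt N f f"
  by (simp add: mps_cong_def)
lemma mps_cong_add: "mps_cong wt N f g \<Longrightarrow> mps_cong wt N f' g' \<Longrightarrow> mps_cong wt N (f + f') (g + g')"
  by (simp add: mps_cong_def)
lemma mps_cong_diff: "mps_cong wt N f g \<Longrightarrow> mps_cong wt N f' g' \<Longrightarrow> mps_cong wt N (f - f') (g - g')"
  by (simp add: mps_cong_def)
text \<open>Additivity of the weight bounds both parts of every decomposition of a monomial by the
  weight of the monomial.\<close>

lemma mps_cong_mult:
  assumes wt: "\<And>a b. wt (a + b) = wt a + wt b"
    and "mps_cong wt N f g" "mps_cong wt N f' g'"
  shows "mps_cong wt N (f * f') (g * g')"
  unfolding mps_cong_def mps_coeff_mult
  using assms(2,3) by (auto intro!: sum.cong simp: mps_cong_def wt)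

lemma mps_eqI_cong: "(\<And>N. mps_cong wt N f g) \<Longrightarrow> f = g"
  by (rule mps_eqI) (auto simp: mps_cong_def)

definition mdeg :: "('v \<Rightarrow>\<^sub>0 nat) \<Rightarrow> nat" where
  "mdeg m = Sum_any (Poly_Mapping.lookup m)"

lemma mdeg_add: "mdeg (a + b) = mdeg a + mdeg b"
  unfolding mdeg_def by (simp add: lookup_add Sum_any.distrib)

lemma mdeg_eq_0_iff: "mdeg a = 0 \<longleftrightarrow> a = 0"
  unfolding mdeg_def poly_mapping_eq_iff by (simp add: fun_eq_iff Sum_any_eq_zero_iff)

lemma mps_coeff_mult_eq_0:
  fixes wt :: "('v \<Rightarrow>\<^sub>0 nat) \<Rightarrow> nat"
  assumes wt: "\<And>a b. wt (a + b) = wt a + wt b"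
    and "\<And>a. wt a < i \<Longrightarrow> mps_coeff f a = 0" "\<And>b. wt b < j \<Longrightarrow> mps_coeff g b = 0" "wt m < i + j"
  shows "mps_coeff (f * g) m = 0"
proof (rule ccontr)
  assume "mps_coeff (f * g) m \<noteq> 0"
  then obtain a b where "m = a + b" "mps_coeff f a \<noteq> 0" "mps_coeff g b \<noteq> 0"
    by (rule mps_coeff_mult_nonzeroE)
  with assms show False by (metis add_mono not_le)
qed

lemma mps_coeff_power_eq_0:
  fixes wt :: "('v \<Rightarrow>\<^sub>0 nat) \<Rightarrow> nat"
  assumes wt: "\<And>a b. wt (a + b) = wt a + wt b"
    and "\<And>a. wt a < 1 \<Longrightarrow> mps_coeff f a = 0" "wt m < n"
  shows "mps_coeff (f ^ n) m = 0"
  using assms(3)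
proof (induction n arbitrary: m)
  case (Suc n)
  show ?case unfolding power_Suc
    by (rule mps_coeff_mult_eq_0[of wt 1 _ n]) (use Suc assms in auto)
qed simp

lemma mps_coeff_power_mdeg_eq_0:
  "mps_coeff f 0 = 0 \<Longrightarrow> mdeg m < n \<Longrightarrow> mps_coeff (f ^ n) m = 0"
  by (rule mps_coeff_power_eq_0[of mdeg]) (auto simp: mdeg_add mdeg_eq_0_iff)

section \<open>The exponential law\<close>

definition exp_part :: "nat \<Rightarrow> ('v, 'a::field_char_0) mps \<Rightarrow> ('v, 'a) mps" where
  "exp_part N f = (\<Sum>n\<le>N. mps_const (1 / fact n) * f ^ n)"

text \<open>Without a constant term, \<open>f ^ n\<close> has no monomial of degree below
  \<open>n\<close>, so the powers beyond \<open>N\<close> do not reach degree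
  \<open>N\<close>.\<close>

lemma mps_exp_cong_exp_part:
  fixes f :: "('v, 'a::field_char_0) mps"
  assumes "mps_coeff f 0 = 0"
  shows "mps_cong mdeg N (mps_exp f) (exp_part N f)"
  unfolding mps_cong_def
proof (intro allI impI)
  fix m :: "'v \<Rightarrow>\<^sub>0 nat" assume m: "mdeg m \<le> N"
  have "mps_coeff (mps_exp f) m = Sum_any (\<lambda>n. 1 / fact n * mps_coeff (f ^ n) m)"
    by (simp add: mps_exp_def mps_sum_def mps_coeff_const_mult)
  also have "\<dots> = (\<Sum>n\<le>N. 1 / fact n * mps_coeff (f ^ n) m)"
  proof (rule Sum_any.expand_superset)
    show "{n. 1 / fact n * mps_coeff (f ^ n) m \<noteq> 0} \<subseteq> {..N}"
    proof (intro subsetI, rule ccontr)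
      fix n assume "n \<in> {n. 1 / fact n * mps_coeff (f ^ n) m \<noteq> 0}" "n \<notin> {..N}"
      with mps_coeff_power_mdeg_eq_0[OF assms, of m n] m show False by simp
    qed
  qed simp
  finally show "mps_coeff (mps_exp f) m = mps_coeff (exp_part N f) m"
    by (simp add: exp_part_def mps_coeff_sum mps_coeff_const_mult)
qed

text \<open>The product runs over the square \<open>i, j \<le> N\<close>. Up to degree
  \<open>N\<close> only the triangle \<open>i + j \<le> N\<close> matters, and its diagonals are the
  binomial expansions of the powers of \<open>f + g\<close>.\<close>

lemma exp_part_add_cong:
  fixes f g :: "('v, 'a::field_char_0) mps"
  assumes "mps_coeff f 0 = 0" "mps_coeff g 0 = 0"
  shows "mps_cong mdeg N (exp_part N f * exp_part N g) (exp_part N (f + g))"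
  unfolding mps_cong_def
proof (intro allI impI)
  fix m :: "'v \<Rightarrow>\<^sub>0 nat" assume m: "mdeg m \<le> N"
  define t where "t = (\<lambda>(i, j). mps_const (1 / (fact i * fact j)) * (f ^ i * g ^ j))"
  have "exp_part N f * exp_part N g = (\<Sum>ij\<in>{..N} \<times> {..N}. t ij)"
    unfolding exp_part_def sum_product sum.cartesian_product t_def
    by (rule sum.cong) (auto simp: mps_const_mult[symmetric] mult_ac simp flip: mult.assoc[of "mps_const _" "mps_const _"])
  also have "mps_coeff \<dots> m = (\<Sum>ij | fst ij + snd ij \<le> N. mps_coeff (t ij) m)"
    unfolding mps_coeff_sum
  proof (rule sum.mono_neutral_right)
    show "\<forall>ij\<in>{..N} \<times> {..N} - {ij. fst ij + snd ij \<le> N}. mps_coeff (t ij) m = 0"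
    proof
      fix ij assume *: "ij \<in> {..N} \<times> {..N} - {ij. fst ij + snd ij \<le> N}"
      have "mps_coeff (f ^ fst ij * g ^ snd ij) m = 0"
        by (rule mps_coeff_mult_eq_0[of mdeg "fst ij" _ "snd ij"])
          (use assms m * in \<open>auto intro: mps_coeff_power_mdeg_eq_0 simp: mdeg_add\<close>)
      then show "mps_coeff (t ij) m = 0" by (simp add: t_def case_prod_unfold mps_coeff_const_mult)
    qed
  qed auto
  also have "\<dots> = (\<Sum>(n, k)\<in>(SIGMA n:{..N}. {..n}). mps_coeff (t (k, n - k)) m)"
    by (rule sum.reindex_bij_witness[of _ "\<lambda>(n, k). (k, n - k)" "\<lambda>(i, j). (i + j, i)"]) auto
  also have "\<dots> = (\<Sum>n\<le>N. \<Sum>k\<le>n. mps_coeff (t (k, n - k)) m)"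
    by (simp add: sum.Sigma)
  also have "\<dots> = mps_coeff (exp_part N (f + g)) m"
    unfolding exp_part_def mps_coeff_sum
  proof (rule sum.cong[OF refl])
    fix n
    \<comment> \<open>The binomial theorem produces its coefficients as numbers of the series ring;
      they have to become constants to merge with \<open>1 / fact n\<close>.\<close>
    have of_nat: "of_nat k * h = mps_const (of_nat k) * h" for k and h :: "('v, 'a) mps"
    proof (induction k)
      case (Suc k)
      then show ?case by (simp add: mps_const_add mps_const_1 distrib_right)
    qed (simp add: mps_const_0)
    have "mps_const (1 / fact n) * (f + g) ^ n = (\<Sum>k\<le>n. t (k, n - k))"
      unfolding binomial_ring sum_distrib_left
    proof (rule sum.cong[OF refl])
      fix k assume "k \<in> {..n}"
      then have "(1 / fact n :: 'a) * of_nat (n choose k) = 1 / (fact k * fact (n - k))"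
        by (simp add: binomial_fact)
      then show "mps_const (1 / fact n) * (of_nat (n choose k) * f ^ k * g ^ (n - k)) = t (k, n - k)"
        unfolding t_def by (simp only: of_nat mult.assoc split flip: mps_const_mult) (simp only: mps_const_mult[symmetric] mult.assoc[symmetric])
    qed
    then show "(\<Sum>k\<le>n. mps_coeff (t (k, n - k)) m) = mps_coeff (mps_const (1 / fact n) * (f + g) ^ n) m"
      by (simp only: mps_coeff_sum)
  qed
  finally show "mps_coeff (exp_part N f * exp_part N g) m = mps_coeff (exp_part N (f + g)) m" .
qed

lemma mps_exp_add:
  fixes f g :: "('v, 'a::field_char_0) mps"
  assumes "mps_coeff f 0 = 0" "mps_coeff g 0 = 0"
  shows "mps_exp f * mps_exp g = mps_exp (f + g)"
proof (rule mps_eqI_cong)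
  fix N
  have "mps_cong mdeg N (mps_exp f * mps_exp g) (exp_part N f * exp_part N g)"
    by (intro mps_cong_mult mdeg_add mps_exp_cong_exp_part assms)
  moreover have "mps_cong mdeg N (mps_exp (f + g)) (exp_part N (f + g))"
    by (intro mps_exp_cong_exp_part) (simp add: assms)
  ultimately show "mps_cong mdeg N (mps_exp f * mps_exp g) (mps_exp (f + g))"
    using exp_part_add_cong[OF assms, of N] by (simp add: mps_cong_def)
qed

section \<open>Additivity of the time potential\<close>

lemma mps_coeff_time_potential:
  "mps_coeff (time_potential lam :: (param, 'f::field) mps) m
    = Sum_any (\<lambda>k. if k \<in> {1..} \<and> m = Poly_Mapping.single (Time k) 1 then of_int (phi_4D k lam) else 0)"
  unfolding time_potential_def mps_sum_def mps_coeff_Abs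
  by (rule arg_cong[where f = Sum_any], rule ext)
    (simp add: mult.commute[of "mps_var _"] mps_coeff_const_mult mps_coeff_var)

lemma time_potential_add_cong:
  assumes "\<And>k. k \<ge> 1 \<Longrightarrow> phi_4D k lam + phi_4D k mu = phi_4D k lam' + phi_4D k mu'"
  shows "time_potential lam + time_potential mu = (time_potential lam' + time_potential mu' :: (param, 'f::field) mps)"
proof (rule mps_eqI)
  fix m :: "param \<Rightarrow>\<^sub>0 nat"
  \<comment> \<open>\<open>Sum_any\<close> distributes over sums only for finite support; it is
    finite here because \<open>k\<close> contributes only if \<open>Time k\<close> occurs in
    \<open>m\<close>.\<close>
  have fin: "finite {k. (if k \<in> {1..} \<and> m = Poly_Mapping.single (Time k) 1 then of_int (phi_4D k lam) else (0::'f)) \<noteq> 0}" for lam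
  proof (rule finite_subset)
    show "{k. (if k \<in> {1..} \<and> m = Poly_Mapping.single (Time k) 1 then of_int (phi_4D k lam) else (0::'f)) \<noteq> 0}
      \<subseteq> Time -` Poly_Mapping.keys m" by (auto split: if_splits)
    show "finite (Time -` Poly_Mapping.keys m)" by (rule finite_vimageI) (auto intro: injI)
  qed
  show "mps_coeff (time_potential lam + time_potential mu) m
      = mps_coeff (time_potential lam' + time_potential mu' :: (param, 'f) mps) m"
    unfolding mps_coeff_add mps_coeff_time_potential Sum_any.distrib[OF fin fin, symmetric]
    by (rule arg_cong[where f = Sum_any], rule ext)
      (use assms in \<open>auto simp del: of_int_add simp add: of_int_add[symmetric]\<close>)
qed

section \<open>Vandermonde products and removal of corners\<close>

text \<open>The partial fraction expansion of the left hand side as a function of \<open>a\<close>. Its residues are, up to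
  sign, the factors by which the Vandermonde product of \<open>S\<close>, divided by \<open>\<Prod>\<^bsub>s\<in>S\<^esub> s!\<close>, changes when one
  \<open>s \<in> S\<close> is lowered by 1.\<close>

lemma prod_one_minus_inverse_expansion:
  fixes S :: "nat set"
  assumes "finite S" "a \<notin> S"
  shows "of_nat a * (\<Prod>j\<in>S. 1 - 1 / (of_nat a - of_nat j))
    = of_nat a - of_nat (card S)
      - (\<Sum>s\<in>S. of_nat s * (\<Prod>j\<in>S - {s}. 1 - 1 / (of_nat s - of_nat j)) / (of_nat a - of_nat s) :: 'f::field_char_0)"
  using assms
proof (induction S arbitrary: a rule: finite_induct)
  case (insert b S)
  let ?c = "\<lambda>s. of_nat s * (\<Prod>j\<in>S - {s}. 1 - 1 / (of_nat s - of_nat j)) :: 'f"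
  let ?M = "of_nat (card S) :: 'f"
  have a: "a \<noteq> b" "a \<notin> S" using insert by auto
  have sb: "(of_nat s * (\<Prod>j\<in>insert b S - {s}. 1 - 1 / (of_nat s - of_nat j)) :: 'f) = ?c s * (1 - 1 / (of_nat s - of_nat b))"
    if "s \<in> S" for s
  proof -
    have "insert b S - {s} = insert b (S - {s})" using that insert by auto
    then show ?thesis using insert by simp
  qed
  have "insert b S - {b} = S" using insert by auto
  \<comment> \<open>The induction hypothesis is also applied at the new point \<open>b\<close>,
    which is why \<open>a\<close> is arbitrary.\<close>
  then have b: "of_nat b * (\<Prod>j\<in>insert b S - {b}. 1 - 1 / (of_nat b - of_nat j)) = of_nat b - ?M - (\<Sum>s\<in>S. ?c s / (of_nat b - of_nat s))"
    using insert.IH[of b] insert by simp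
  \<comment> \<open>Partial fractions for \<open>1 / ((v - s) * (u - s))\<close>: the new sum
    becomes a combination of the old sums at \<open>a\<close> and at \<open>b\<close>.\<close>
  have frac: "x * (1 - 1 / (s - v)) / (u - s) = x / (u - s) + (x / (v - s) - x / (u - s)) / (u - v)"
    if "u \<noteq> v" "u \<noteq> s" "v \<noteq> s" for x s u v :: 'f
    using that by (simp add: divide_simps) (simp add: algebra_simps)
  have "(\<Sum>s\<in>S. of_nat s * (\<Prod>j\<in>insert b S - {s}. 1 - 1 / (of_nat s - of_nat j)) / (of_nat a - of_nat s))
     = (\<Sum>s\<in>S. ?c s / (of_nat a - of_nat s) + (?c s / (of_nat b - of_nat s) - ?c s / (of_nat a - of_nat s)) / (of_nat a - of_nat b))"
  proof (rule sum.cong[OF refl])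
    fix s assume "s \<in> S"
    then have "s \<noteq> a" "s \<noteq> b" using insert a by auto
    then show "of_nat s * (\<Prod>j\<in>insert b S - {s}. 1 - 1 / (of_nat s - of_nat j)) / (of_nat a - of_nat s)
      = ?c s / (of_nat a - of_nat s) + (?c s / (of_nat b - of_nat s) - ?c s / (of_nat a - of_nat s)) / (of_nat a - of_nat b)"
      unfolding sb[OF \<open>s \<in> S\<close>] using a by (intro frac) auto
  qed
  also have "\<dots> = (\<Sum>s\<in>S. ?c s / (of_nat a - of_nat s))
      + ((\<Sum>s\<in>S. ?c s / (of_nat b - of_nat s)) - (\<Sum>s\<in>S. ?c s / (of_nat a - of_nat s))) / (of_nat a - of_nat b)"
    by (simp add: sum.distrib sum_divide_distrib sum_subtractf diff_divide_distrib)
  finally have S: "(\<Sum>s\<in>S. of_nat s * (\<Prod>j\<in>insert b S - {s}. 1 - 1 / (of_nat s - of_nat j)) / (of_nat a - of_nat s))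
     = \<dots>" .
  have "of_nat a * (\<Prod>j\<in>insert b S. 1 - 1 / (of_nat a - of_nat j))
      = (1 - 1 / (of_nat a - of_nat b)) * (of_nat a - ?M - (\<Sum>s\<in>S. ?c s / (of_nat a - of_nat s)))"
    using insert.IH[OF a(2)] insert.hyps by (simp add: mult_ac)
  also have "\<dots> = of_nat a - of_nat (card (insert b S))
      - ((of_nat b - ?M - (\<Sum>s\<in>S. ?c s / (of_nat b - of_nat s))) / (of_nat a - of_nat b)
      + ((\<Sum>s\<in>S. ?c s / (of_nat a - of_nat s))
      + ((\<Sum>s\<in>S. ?c s / (of_nat b - of_nat s)) - (\<Sum>s\<in>S. ?c s / (of_nat a - of_nat s))) / (of_nat a - of_nat b)))"
  proof -
    have "(1 - 1 / (u - v)) * (u - m - x) = u - (1 + m) - ((v - m - y) / (u - v) + (x + (y - x) / (u - v)))"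
      if "u \<noteq> v" for u v m x y :: 'f
      using that by (simp add: divide_simps) (simp add: algebra_simps)
    then show ?thesis using a insert.hyps by simp
  qed
  finally show ?case using insert.hyps b S by simp
qed simp

text \<open>When \<open>a\<close> is added, each old term gains \<open>?c s / (a - s)\<close>, and
  the expansion of the new term cancels exactly these, leaving \<open>a - card S\<close>. For a beta
  set the right hand side is the size of the partition.\<close>

lemma sum_prod_one_minus_inverse:
  fixes S :: "nat set"
  assumes "finite S"
  shows "(\<Sum>s\<in>S. of_nat s * (\<Prod>j\<in>S - {s}. 1 - 1 / (of_nat s - of_nat j)))
    = (of_nat (\<Sum>S) - of_nat (\<Sum>i<card S. i) :: 'f::field_char_0)"
  using assms
proof (induction S rule: finite_induct)
  case (insert a S)
  let ?c = "\<lambda>s. of_nat s * (\<Prod>j\<in>S - {s}. 1 - 1 / (of_nat s - of_nat j)) :: 'f"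
  have c: "(of_nat s * (\<Prod>j\<in>insert a S - {s}. 1 - 1 / (of_nat s - of_nat j)) :: 'f)
      = ?c s + ?c s / (of_nat a - of_nat s)" if "s \<in> S" for s
  proof -
    have "insert a S - {s} = insert a (S - {s})" using that insert by auto
    moreover have "1 / (of_nat s - of_nat a) = - (1 / (of_nat a - of_nat s :: 'f))"
      by (metis minus_diff_eq divide_minus_right)
    ultimately show ?thesis using insert by (simp add: algebra_simps)
  qed
  have "insert a S - {a} = S" using insert by auto
  moreover have "(\<Sum>s\<in>S. of_nat s * (\<Prod>j\<in>insert a S - {s}. 1 - 1 / (of_nat s - of_nat j)) :: 'f)
      = (\<Sum>s\<in>S. ?c s + ?c s / (of_nat a - of_nat s))"
    by (rule sum.cong[OF refl c])
  ultimately have "(\<Sum>s\<in>insert a S. of_nat s * (\<Prod>j\<in>insert a S - {s}. 1 - 1 / (of_nat s - of_nat j)) :: 'f)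
      = of_nat a * (\<Prod>j\<in>S. 1 - 1 / (of_nat a - of_nat j)) + (\<Sum>s\<in>S. ?c s + ?c s / (of_nat a - of_nat s))"
    unfolding sum.insert[OF insert.hyps] by (simp only:)
  also have "\<dots> = of_nat a - of_nat (card S) + (of_nat (\<Sum>S) - of_nat (\<Sum>i<card S. i))"
    unfolding prod_one_minus_inverse_expansion[OF insert.hyps] sum.distrib insert.IH by simp
  finally show ?case using insert.hyps by simp
qed simp

text \<open>\<open>max a b - min a b\<close> is the distance on naturals: the truncated subtraction
  is exact, and the expression is symmetric for all \<open>a\<close>, \<open>b\<close>, as
  \<open>prod_pairs_insert\<close> demands.\<close>

definition vandermonde :: "nat set \<Rightarrow> nat" where
  "vandermonde A = (\<Prod>a\<in>A. \<Prod>b\<in>{b\<in>A. b < a}. max a b - min a b)"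

lemma vandermonde_insert:
  "finite A \<Longrightarrow> p \<notin> A \<Longrightarrow> vandermonde (insert p A) = vandermonde A * (\<Prod>b\<in>A. max p b - min p b)"
  unfolding vandermonde_def by (rule prod_pairs_insert) (auto simp: max.commute min.commute)

lemma sqdisc_eq_vandermonde: "sqdisc A = (of_nat (vandermonde A) :: 'f::field)\<^sup>2"
  unfolding sqdisc_def vandermonde_def of_nat_prod prod_power_distrib
  by (intro prod.cong refl) (auto simp: of_nat_diff)

text \<open>Since \<open>j\<close> is neither \<open>s\<close> nor \<open>s - 1\<close>, both stay
  on the same side of \<open>j\<close>, and on either side the distance to \<open>j\<close> is
  multiplied by \<open>1 - 1 / (s - j)\<close>.\<close>

lemma vandermonde_lower:
  assumes "finite A" "s \<notin> A" "s - 1 \<notin> A" "s \<ge> 1"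
  shows "of_nat (vandermonde (insert (s - 1) A))
    = of_nat (vandermonde (insert s A)) * (\<Prod>j\<in>A. 1 - 1 / (of_nat s - of_nat j) :: 'f::field_char_0)"
proof -
  have "(of_nat (max (s - 1) j - min (s - 1) j) :: 'f)
      = of_nat (max s j - min s j) * (1 - 1 / (of_nat s - of_nat j))" if "j \<in> A" for j
  proof -
    have "j \<noteq> s" "j \<noteq> s - 1" using that assms by auto
    then consider "j < s - 1" | "s < j" by linarith
    then show ?thesis
    proof cases
      case 1
      then show ?thesis by (simp add: of_nat_diff divide_simps)
    next
      case 2
      then show ?thesis using assms(4) by (simp add: of_nat_diff divide_simps) (simp add: algebra_simps)
    qed
  qed
  then show ?thesis
    using assms by (simp add: vandermonde_insert prod.distrib[symmetric] mult.assoc)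
qed

section \<open>Beta numbers of partitions with at most M parts\<close>

text \<open>The beta numbers of \<open>lam\<close>, padded with zeros to \<open>M\<close> rows. With
  rows counted from 0 the shift is \<open>M - 1 - i\<close>, and for \<open>i < M\<close> the
  subtraction is exact.\<close>

definition beta_set :: "nat \<Rightarrow> (nat \<Rightarrow> nat) \<Rightarrow> nat set" where
  "beta_set M lam = (\<lambda>i. lam i + (M - 1 - i)) ` {..<M}"

definition short_partitions :: "nat \<Rightarrow> (nat \<Rightarrow> nat) set" where
  "short_partitions M = {lam. antimono lam \<and> (\<forall>i\<ge>M. lam i = 0)}"

lemma short_partition_support: "lam \<in> short_partitions M \<Longrightarrow> {i. lam i \<noteq> 0} \<subseteq> {..<M}"
  unfolding short_partitions_def by (auto simp: not_less[symmetric])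

lemma short_partitions_subset: "short_partitions M \<subseteq> partitions"
proof
  fix lam assume lam: "lam \<in> short_partitions M"
  then have "finite {i. lam i \<noteq> 0}"
    using short_partition_support finite_subset by blast
  with lam show "lam \<in> partitions" by (simp add: partitions_def short_partitions_def)
qed

lemma beta_strict:
  assumes "lam \<in> short_partitions M" "i < j" "j < M"
  shows "lam j + (M - 1 - j) < lam i + (M - 1 - i)"
proof -
  have "lam j \<le> lam i" using assms antimonoD[of lam i j] by (auto simp: short_partitions_def)
  then show ?thesis using assms by linarith
qed

lemma beta_inj: "lam \<in> short_partitions M \<Longrightarrow> inj_on (\<lambda>i. lam i + (M - 1 - i)) {..<M}"
  by (rule linorder_inj_onI) (auto dest: beta_strict)

lemma finite_beta_set [simp]: "finite (beta_set M lam)"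
  by (simp add: beta_set_def)

lemma card_beta_set: "lam \<in> short_partitions M \<Longrightarrow> card (beta_set M lam) = M"
  unfolding beta_set_def by (simp only: card_image beta_inj card_lessThan)

lemma sum_beta_set:
  "lam \<in> short_partitions M \<Longrightarrow> sum h (beta_set M lam) = (\<Sum>i<M. h (lam i + (M - 1 - i)))"
  unfolding beta_set_def by (rule sum.reindex[OF beta_inj, unfolded o_def])

lemma prod_beta_set:
  "lam \<in> short_partitions M \<Longrightarrow> prod h (beta_set M lam) = (\<Prod>i<M. h (lam i + (M - 1 - i)))"
  unfolding beta_set_def by (rule prod.reindex[OF beta_inj, unfolded o_def])

lemma psize_short: "lam \<in> short_partitions M \<Longrightarrow> psize lam = (\<Sum>i<M. lam i)"
  unfolding psize_def by (rule Sum_any.expand_superset) (auto dest: short_partition_support)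

lemma sum_beta_set_eq:
  assumes "lam \<in> short_partitions M"
  shows "\<Sum>(beta_set M lam) = psize lam + (\<Sum>i<M. i)"
proof -
  have "(\<Sum>i<M. M - 1 - i) = (\<Sum>i<M. i)" using sum.nat_diff_reindex[of "\<lambda>i. i" M] by simp
  then show ?thesis unfolding sum_beta_set[OF assms] psize_short[OF assms] sum.distrib by simp
qed

section \<open>Removal of a corner\<close>

definition corners :: "(nat \<Rightarrow> nat) \<Rightarrow> nat set" where
  "corners lam = {i. lam (Suc i) < lam i}"

lemma corners_less: "lam \<in> short_partitions M \<Longrightarrow> i \<in> corners lam \<Longrightarrow> i < M"
  by (rule ccontr) (auto simp: corners_def short_partitions_def)

lemma remove_corner_short:
  assumes "lam \<in> short_partitions M" "i \<in> corners lam"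
  shows "lam(i := lam i - 1) \<in> short_partitions M"
proof -
  have anti: "antimono lam" using assms by (simp add: short_partitions_def)
  have "antimono (lam(i := lam i - 1))"
  proof (rule antimonoI)
    fix x y :: nat assume "x \<le> y"
    have "lam y \<le> lam (Suc i)" if "y > i" using antimonoD[OF anti, of "Suc i" y] that by simp
    then show "(lam(i := lam i - 1)) y \<le> (lam(i := lam i - 1)) x"
      using antimonoD[OF anti \<open>x \<le> y\<close>] assms(2) \<open>x \<le> y\<close> by (fastforce simp: corners_def)
  qed
  then show ?thesis using assms corners_less[OF assms] by (auto simp: short_partitions_def)
qed

lemma psize_remove_corner:
  assumes "lam \<in> short_partitions M" "i \<in> corners lam"
  shows "psize lam = Suc (psize (lam(i := lam i - 1)))"
proof -
  have "i < M" by (rule corners_less[OF assms])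
  have "(\<Sum>j<M. lam j) = lam i + (\<Sum>j\<in>{..<M} - {i}. lam j)"
    using \<open>i < M\<close> by (subst sum.remove[of _ i]) auto
  moreover have "(\<Sum>j<M. (lam(i := lam i - 1)) j) = (lam i - 1) + (\<Sum>j\<in>{..<M} - {i}. lam j)"
    using \<open>i < M\<close> by (subst sum.remove[of _ i]) auto
  moreover have "lam i \<ge> 1" using assms(2) by (auto simp: corners_def)
  ultimately show ?thesis
    using psize_short[OF assms(1)] psize_short[OF remove_corner_short[OF assms]] by simp
qed

text \<open>Removing a box lowers one beta number by 1. The place \<open>s - 1\<close> is free
  because the next row is strictly shorter.\<close>

lemma beta_set_remove_corner:
  assumes "lam \<in> short_partitions M" "i \<in> corners lam"
  defines "s \<equiv> lam i + (M - 1 - i)"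
  shows "beta_set M (lam(i := lam i - 1)) = insert (s - 1) (beta_set M lam - {s})"
    "s \<ge> 1" "s \<in> beta_set M lam" "s - 1 \<notin> beta_set M lam"
proof -
  have i: "i < M" by (rule corners_less[OF assms(1,2)])
  show s1: "s \<ge> 1" using assms(2) by (auto simp: corners_def s_def)
  show "s \<in> beta_set M lam" using i by (auto simp: beta_set_def s_def)
  show "s - 1 \<notin> beta_set M lam"
  proof
    assume "s - 1 \<in> beta_set M lam"
    then obtain j where j: "j < M" "s - 1 = lam j + (M - 1 - j)" by (auto simp: beta_set_def)
    \<comment> \<open>Rows up to \<open>i\<close> have beta numbers at least \<open>s\<close>, and
      rows beyond \<open>Suc i\<close> lie below row \<open>Suc i\<close>. Only row
      \<open>Suc i\<close> could reach \<open>s - 1\<close>, and only if it were as long as row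
      \<open>i\<close>.\<close>
    consider "j \<le> i" | "j = Suc i" | "j > Suc i" by linarith
    then show False
    proof cases
      case 1
      then have "lam j + (M - 1 - j) \<ge> s" using beta_strict[OF assms(1), of j i] i by (cases "j = i") (auto simp: s_def)
      then show False using j s1 by simp
    next
      case 2
      then show False using j assms(2) by (auto simp: corners_def s_def)
    next
      case 3
      then have "lam j + (M - 1 - j) < lam (Suc i) + (M - 1 - Suc i)"
        using beta_strict[OF assms(1), of "Suc i" j] j by simp
      then show False using 3 j assms(2) by (auto simp: corners_def s_def)
    qed
  qed
  have "beta_set M (lam(i := lam i - 1))
      = insert (s - 1) ((\<lambda>i. lam i + (M - 1 - i)) ` ({..<M} - {i}))"
  proof -
    have "{..<M} = insert i ({..<M} - {i})" using i by auto
    then have "beta_set M (lam(i := lam i - 1)) = (\<lambda>j. (lam(i := lam i - 1)) j + (M - 1 - j)) ` insert i ({..<M} - {i})"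
      unfolding beta_set_def by simp
    moreover have "lam i - 1 + (M - 1 - i) = s - 1" using assms(2) by (auto simp: corners_def s_def)
    ultimately show ?thesis by auto
  qed
  also have "(\<lambda>i. lam i + (M - 1 - i)) ` ({..<M} - {i}) = beta_set M lam - {s}"
    unfolding beta_set_def s_def using i by (subst inj_on_image_set_diff[OF beta_inj[OF assms(1)]]) auto
  finally show "beta_set M (lam(i := lam i - 1)) = insert (s - 1) (beta_set M lam - {s})" .
qed

text \<open>If the next row has equal length, \<open>s - 1\<close> is itself a beta number and its
  factor is \<open>1 - 1 / 1 = 0\<close>. In the last row, \<open>M - 1\<close>, a missing corner
  means an empty row, hence \<open>s = 0\<close>. Sums over corners can therefore be extended to all
  rows.\<close>

lemma not_corner_weight_0:
  assumes "lam \<in> short_partitions M" "i \<notin> corners lam" "i < M"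
  defines "s \<equiv> lam i + (M - 1 - i)"
  shows "of_nat s * (\<Prod>j\<in>beta_set M lam - {s}. 1 - 1 / (of_nat s - of_nat j)) = (0 :: 'f::field_char_0)"
proof -
  have eq: "lam (Suc i) = lam i" using assms antimonoD[of lam i "Suc i"]
    by (auto simp: corners_def short_partitions_def intro: antisym)
  show ?thesis
  proof (cases "Suc i < M")
    case True
    then have "s - 1 \<in> beta_set M lam - {s}" "s \<ge> 1"
      using eq unfolding beta_set_def s_def by (auto intro!: image_eqI[of _ _ "Suc i"])
    moreover have "1 - 1 / (of_nat s - of_nat (s - 1)) = (0 :: 'f)" using \<open>s \<ge> 1\<close> by (simp add: of_nat_diff)
    ultimately have "(\<Prod>j\<in>beta_set M lam - {s}. 1 - 1 / (of_nat s - of_nat j)) = (0 :: 'f)"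
      using \<open>s - 1 \<in> _\<close> by (intro prod_zero bexI[of _ "s - 1"]) simp_all
    then show ?thesis by simp
  next
    case False
    then have "Suc i = M" using assms by simp
    then have "s = 0" using assms(1) eq by (auto simp: s_def short_partitions_def)
    then show ?thesis by simp
  qed
qed

section \<open>The Frobenius weight and its recursion\<close>

text \<open>The Frobenius formula for the number of standard tableaux divided by the factorial of
  the size, as \<open>pdim_eq_beta_weight\<close> confirms.\<close>

definition beta_weight :: "nat set \<Rightarrow> 'f::field_char_0" where
  "beta_weight S = of_nat (vandermonde S) / (\<Prod>s\<in>S. fact s)"

lemma beta_weight_lower:
  assumes "finite S" "s \<in> S" "s - 1 \<notin> S" "s \<ge> 1"
  shows "beta_weight (insert (s - 1) (S - {s}))
    = beta_weight S * (of_nat s * (\<Prod>j\<in>S - {s}. 1 - 1 / (of_nat s - of_nat j)) :: 'f::field_char_0)"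
proof -
  have S: "S = insert s (S - {s})" using assms by auto
  have "(\<Prod>s\<in>S. fact s :: 'f) = fact s * (\<Prod>s\<in>S - {s}. fact s)" using assms by (simp add: prod.remove)
  moreover have "fact s = of_nat s * (fact (s - 1) :: 'f)" using assms by (simp add: fact_reduce)
  moreover have "(\<Prod>s\<in>insert (s - 1) (S - {s}). fact s :: 'f) = fact (s - 1) * (\<Prod>s\<in>S - {s}. fact s)"
    using assms by simp
  moreover have "of_nat (vandermonde (insert (s - 1) (S - {s})))
    = of_nat (vandermonde S) * (\<Prod>j\<in>S - {s}. 1 - 1 / (of_nat s - of_nat j) :: 'f)"
    using vandermonde_lower[of "S - {s}" s, folded S] assms S by (auto simp: insert_absorb)
  ultimately show ?thesis
    using assms(4) unfolding beta_weight_def by simp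
qed

text \<open>The counterpart of the branching rule \<open>pdim_branching\<close> for the Frobenius
  formula. The factors by which the weight changes add up, over all rows, to the size of
  \<open>lam\<close>.\<close>

lemma sum_beta_weight_corners:
  assumes lam: "lam \<in> short_partitions M"
  shows "(\<Sum>i\<in>corners lam. beta_weight (beta_set M (lam(i := lam i - 1))))
    = of_nat (psize lam) * (beta_weight (beta_set M lam) :: 'f::field_char_0)"
proof -
  let ?S = "beta_set M lam"
  let ?g = "\<lambda>s. of_nat s * (\<Prod>j\<in>?S - {s}. 1 - 1 / (of_nat s - of_nat j)) :: 'f"
  have "(\<Sum>i\<in>corners lam. beta_weight (beta_set M (lam(i := lam i - 1))))
      = (\<Sum>i\<in>corners lam. beta_weight ?S * ?g (lam i + (M - 1 - i)))"
  proof (rule sum.cong[OF refl])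
    fix i assume "i \<in> corners lam"
    note b = beta_set_remove_corner[OF lam this]
    show "beta_weight (beta_set M (lam(i := lam i - 1))) = beta_weight ?S * ?g (lam i + (M - 1 - i))"
      unfolding b(1) by (rule beta_weight_lower[OF _ b(3,4,2)]) simp
  qed
  also have "\<dots> = (\<Sum>i<M. beta_weight ?S * ?g (lam i + (M - 1 - i)))"
    using corners_less[OF lam] not_corner_weight_0[OF lam]
    by (intro sum.mono_neutral_left) auto
  also have "\<dots> = beta_weight ?S * (\<Sum>s\<in>?S. ?g s)"
    by (simp only: sum_beta_set[OF lam] sum_distrib_left)
  also have "(\<Sum>s\<in>?S. ?g s) = of_nat (psize lam)"
    by (simp add: sum_prod_one_minus_inverse card_beta_set[OF lam] sum_beta_set_eq[OF lam])
  finally show ?thesis by (simp only: mult.commute)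
qed

section \<open>Counting standard tableaux\<close>

lemma young_diagram_remove_corner:
  assumes "i \<in> corners lam"
  shows "young_diagram lam = insert (i, lam i - 1) (young_diagram (lam(i := lam i - 1)))"
    "(i, lam i - 1) \<notin> young_diagram (lam(i := lam i - 1))"
  using assms by (auto simp: young_diagram_def corners_def split: if_splits)

lemma finite_young_diagram: "lam \<in> short_partitions M \<Longrightarrow> finite (young_diagram lam)"
proof (rule finite_subset)
  assume "lam \<in> short_partitions M"
  then show "young_diagram lam \<subseteq> (SIGMA i:{..<M}. {..<lam i})"
    unfolding young_diagram_def short_partitions_def by (auto simp: not_less[symmetric])
qed simp

lemma finite_standard_tableaux:
  assumes "lam \<in> short_partitions M"
  shows "finite (standard_tableaux lam)"
proof (rule finite_subset)
  show "standard_tableaux lam \<subseteq> (young_diagram lam \<rightarrow>\<^sub>E {1..psize lam})"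
    unfolding standard_tableaux_def PiE_def by (auto dest: bij_betwE)
  show "finite (young_diagram lam \<rightarrow>\<^sub>E {1..psize lam})"
    by (intro finite_PiE finite_young_diagram[OF assms]) simp
qed

text \<open>Deleting the box with the largest entry is a bijection onto the tableaux of the smaller
  shape; putting the box back is the inverse.\<close>

lemma card_tableaux_max_at_corner:
  assumes lam: "lam \<in> short_partitions M" and i: "i \<in> corners lam"
  shows "card {t \<in> standard_tableaux lam. t (i, lam i - 1) = psize lam} = pdim (lam(i := lam i - 1))"
proof -
  define mu c where "mu = lam(i := lam i - 1)" and "c = (i, lam i - 1)"
  have Y: "young_diagram lam = insert c (young_diagram mu)" "c \<notin> young_diagram mu"
    unfolding mu_def c_def by (rule young_diagram_remove_corner[OF i])+
  have n: "psize lam = Suc (psize mu)" unfolding mu_def by (rule psize_remove_corner[OF lam i])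
  have anti: "antimono lam" "antimono mu"
    using lam remove_corner_short[OF lam i] by (auto simp: short_partitions_def mu_def)
  have ins: "{1..psize lam} = insert (psize lam) {1..psize mu}" "psize lam \<notin> {1..psize mu}"
    unfolding n by auto
  have "bij_betw (\<lambda>t. restrict t (young_diagram mu))
      {t \<in> standard_tableaux lam. t c = psize lam} (standard_tableaux mu)"
  proof (rule bij_betw_byWitness[where f' = "\<lambda>t. t(c := psize lam)"])
    show "\<forall>t\<in>{t \<in> standard_tableaux lam. t c = psize lam}. (restrict t (young_diagram mu))(c := psize lam) = t"
    proof (intro ballI ext)
      fix t x assume "t \<in> {t \<in> standard_tableaux lam. t c = psize lam}"
      then show "((restrict t (young_diagram mu))(c := psize lam)) x = t x"
        using Y by (cases x) (auto simp: standard_tableaux_def restrict_def extensional_def)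
    qed
    show "\<forall>t\<in>standard_tableaux mu. restrict (t(c := psize lam)) (young_diagram mu) = t"
    proof (intro ballI ext)
      fix t x assume "t \<in> standard_tableaux mu"
      then show "restrict (t(c := psize lam)) (young_diagram mu) x = t x"
        using Y(2) by (cases x) (auto simp: standard_tableaux_def restrict_def extensional_def)
    qed
    show "(\<lambda>t. restrict t (young_diagram mu)) ` {t \<in> standard_tableaux lam. t c = psize lam} \<subseteq> standard_tableaux mu"
    proof (rule image_subsetI)
      fix t assume "t \<in> {t \<in> standard_tableaux lam. t c = psize lam}"
      then have t: "bij_betw t (young_diagram lam) {1..psize lam}" "t c = psize lam"
        "\<And>i j j'. j < j' \<Longrightarrow> (i, j') \<in> young_diagram lam \<Longrightarrow> t (i, j) < t (i, j')"
        "\<And>i i' j. i < i' \<Longrightarrow> (i', j) \<in> young_diagram lam \<Longrightarrow> t (i, j) < t (i', j)"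
        by (auto simp: standard_tableaux_def)
      have "bij_betw t (young_diagram mu) {1..psize mu}"
        using notIn_Un_bij_betw3[of c "young_diagram mu" t "{1..psize mu}"] t(1,2) Y ins by simp
      then have "bij_betw (restrict t (young_diagram mu)) (young_diagram mu) {1..psize mu}"
        by simp
      moreover have "restrict t (young_diagram mu) (k, j) < restrict t (young_diagram mu) (k, j')"
        if "j < j'" "(k, j') \<in> young_diagram mu" for k j j'
      proof -
        have "(k, j) \<in> young_diagram mu" using that by (auto simp: young_diagram_def)
        then show ?thesis using that t(3)[of j j' k] Y(1) by simp
      qed
      moreover have "restrict t (young_diagram mu) (k, j) < restrict t (young_diagram mu) (k', j)"
        if "k < k'" "(k', j) \<in> young_diagram mu" for k k' j
      proof -
        have "(k, j) \<in> young_diagram mu"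
          using that antimonoD[OF anti(2), of k k'] by (auto simp: young_diagram_def)
        then show ?thesis using that t(4)[of k k' j] Y(1) by simp
      qed
      ultimately show "restrict t (young_diagram mu) \<in> standard_tableaux mu"
        unfolding standard_tableaux_def by blast
    qed
    show "(\<lambda>t. t(c := psize lam)) ` standard_tableaux mu \<subseteq> {t \<in> standard_tableaux lam. t c = psize lam}"
    proof (rule image_subsetI)
      fix t assume "t \<in> standard_tableaux mu"
      then have t: "t \<in> extensional (young_diagram mu)" "bij_betw t (young_diagram mu) {1..psize mu}"
        "\<And>i j j'. j < j' \<Longrightarrow> (i, j') \<in> young_diagram mu \<Longrightarrow> t (i, j) < t (i, j')"
        "\<And>i i' j. i < i' \<Longrightarrow> (i', j) \<in> young_diagram mu \<Longrightarrow> t (i, j) < t (i', j)"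
        by (auto simp: standard_tableaux_def)
      define u where "u = t(c := psize lam)"
      have uc: "u c = psize lam" and un: "\<And>x. x \<noteq> c \<Longrightarrow> u x = t x" by (auto simp: u_def)
      have small: "t x < psize lam" if "x \<in> young_diagram mu" for x
        using bij_betwE[OF t(2)] that n by force
      have "u x = t x" if "x \<in> young_diagram mu" for x
        by (rule un) (use that Y(2) in blast)
      then have "bij_betw u (young_diagram mu) {1..psize mu}"
        using t(2) bij_betw_cong by blast
      then have "bij_betw u (young_diagram lam) {1..psize lam}"
        using notIn_Un_bij_betw3[of c "young_diagram mu" u "{1..psize mu}"] Y ins uc by simp
      moreover have "u \<in> extensional (young_diagram lam)"
        using t(1) Y(1) un by (auto simp: extensional_def)
      moreover have "u (k, j) < u (k, j')" if "j < j'" "(k, j') \<in> young_diagram lam" for k j j'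
      proof -
        have "(k, j) \<noteq> c" using that by (auto simp: c_def young_diagram_def)
        moreover have "(k, j) \<in> young_diagram lam" using that by (auto simp: young_diagram_def)
        ultimately show ?thesis using that t(3)[of j j' k] small[of "(k, j)"] Y(1) uc un
          by (cases "(k, j') = c") auto
      qed
      moreover have "u (k, j) < u (k', j)" if "k < k'" "(k', j) \<in> young_diagram lam" for k k' j
      proof -
        \<comment> \<open>A box with another box below it is not the corner \<open>c\<close>, so its
          entry is an old one and smaller than \<open>psize lam\<close>.\<close>
        have "lam k' \<le> lam (Suc k)" using that antimonoD[OF anti(1), of "Suc k" k'] by simp
        then have "(k, j) \<noteq> c" using that i by (auto simp: c_def young_diagram_def corners_def)
        moreover have "(k, j) \<in> young_diagram lam"
          using that antimonoD[OF anti(1), of k k'] by (auto simp: young_diagram_def)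
        ultimately show ?thesis using that t(4)[of k k' j] small[of "(k, j)"] Y(1) uc un
          by (cases "(k', j) = c") auto
      qed
      ultimately show "t(c := psize lam) \<in> {t \<in> standard_tableaux lam. t c = psize lam}"
        using uc unfolding standard_tableaux_def u_def by simp
    qed
  qed
  then show ?thesis unfolding pdim_def c_def mu_def by (rule bij_betw_same_card)
qed

text \<open>The largest entry has no box to its right or below it, so it sits at the end of a row
  that is a corner, and it determines this corner uniquely.\<close>

lemma pdim_branching:
  assumes lam: "lam \<in> short_partitions M" and n: "psize lam > 0"
  shows "pdim lam = (\<Sum>i\<in>corners lam. pdim (lam(i := lam i - 1)))"
proof -
  let ?T = "\<lambda>i. {t \<in> standard_tableaux lam. t (i, lam i - 1) = psize lam}"
  have "standard_tableaux lam \<subseteq> (\<Union>i\<in>corners lam. ?T i)"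
  proof
    fix t assume t: "t \<in> standard_tableaux lam"
    then have bij: "bij_betw t (young_diagram lam) {1..psize lam}" by (simp add: standard_tableaux_def)
    moreover have "psize lam \<in> {1..psize lam}" using n by simp
    ultimately obtain i j where ij: "(i, j) \<in> young_diagram lam" "t (i, j) = psize lam"
      by (metis bij_betw_imp_surj_on imageE surj_pair)
    have max: "t x \<le> psize lam" if "x \<in> young_diagram lam" for x
      using bij_betwE[OF bij] that by auto
    have "(i, Suc j) \<notin> young_diagram lam"
    proof
      assume *: "(i, Suc j) \<in> young_diagram lam"
      then have "t (i, j) < t (i, Suc j)" using t by (auto simp: standard_tableaux_def)
      with max[OF *] ij show False by simp
    qed
    moreover have "(Suc i, j) \<notin> young_diagram lam"
    proof
      assume *: "(Suc i, j) \<in> young_diagram lam"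
      then have "t (i, j) < t (Suc i, j)" using t by (auto simp: standard_tableaux_def)
      with max[OF *] ij show False by simp
    qed
    ultimately have "j = lam i - 1" "i \<in> corners lam"
      using ij(1) by (auto simp: young_diagram_def corners_def)
    then show "t \<in> (\<Union>i\<in>corners lam. ?T i)" using t ij(2) by auto
  qed
  then have "standard_tableaux lam = (\<Union>i\<in>corners lam. ?T i)" by auto
  then have "pdim lam = card (\<Union>i\<in>corners lam. ?T i)" by (simp add: pdim_def)
  also have "\<dots> = (\<Sum>i\<in>corners lam. card (?T i))"
  proof (rule card_UN_disjoint)
    show "finite (corners lam)" using corners_less[OF lam] by (meson bounded_nat_set_is_finite)
    show "\<forall>i\<in>corners lam. finite (?T i)" using finite_standard_tableaux[OF lam] by simp
    show "\<forall>i\<in>corners lam. \<forall>j\<in>corners lam. i \<noteq> j \<longrightarrow> ?T i \<inter> ?T j = {}"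
    proof (intro ballI impI equals0I)
      fix i j t assume ij: "i \<in> corners lam" "j \<in> corners lam" "i \<noteq> j" and "t \<in> ?T i \<inter> ?T j"
      then have "inj_on t (young_diagram lam)" "t (i, lam i - 1) = t (j, lam j - 1)"
        by (auto simp: standard_tableaux_def bij_betw_def)
      moreover have "(i, lam i - 1) \<in> young_diagram lam" "(j, lam j - 1) \<in> young_diagram lam"
        using young_diagram_remove_corner(1)[OF ij(1)] young_diagram_remove_corner(1)[OF ij(2)] by auto
      ultimately show False using ij(3) by (metis inj_onD prod.inject)
    qed
  qed
  also have "\<dots> = (\<Sum>i\<in>corners lam. pdim (lam(i := lam i - 1)))"
    by (intro sum.cong refl card_tableaux_max_at_corner[OF lam])
  finally show ?thesis .
qed

lemma pdim_psize_0:
  assumes "lam \<in> short_partitions M" "psize lam = 0"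
  shows "pdim lam = 1" "beta_weight (beta_set M lam) = (1 :: 'f::field_char_0)"
proof -
  have "lam i = 0" for i
    using assms psize_short[OF assms(1)] by (cases "i < M") (auto simp: short_partitions_def)
  then have lam0: "lam = (\<lambda>_. 0)" by auto
  then have "young_diagram lam = {}" by (auto simp: young_diagram_def)
  then have "standard_tableaux lam = {\<lambda>_. undefined}"
    using assms(2) by (auto simp: standard_tableaux_def bij_betw_def)
  then show "pdim lam = 1" by (simp add: pdim_def)
  have "beta_set M lam = {..<M}"
  proof (rule card_subset_eq)
    show "beta_set M lam \<subseteq> {..<M}" unfolding lam0 beta_set_def by auto
    show "card (beta_set M lam) = card {..<M}" using card_beta_set[OF assms(1)] by simp
  qed simp
  \<comment> \<open>The empty partition has the beta numbers \<open>0\<close> to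
    \<open>M - 1\<close>; their Vandermonde product cancels the factorials in
    \<open>beta_weight\<close>.\<close>
  moreover have "vandermonde {..<M} = (\<Prod>s<M. fact s)" for M
  proof (induction M)
    case (Suc M)
    have "(\<Prod>b<M. max M b - min M b) = (\<Prod>b<M. M - b)" by (intro prod.cong) auto
    also have "\<dots> = fact M" by (simp add: fact_prod_rev lessThan_atLeast0)
    finally show ?case using Suc by (simp add: lessThan_Suc vandermonde_insert)
  qed (simp add: vandermonde_def)
  ultimately show "beta_weight (beta_set M lam) = (1 :: 'f)"
    by (simp add: beta_weight_def)
qed

text \<open>Both sides agree on the empty shape and satisfy the same recursion over the removal of a
  corner.\<close>

lemma pdim_eq_beta_weight:
  assumes "lam \<in> short_partitions M"
  shows "of_nat (pdim lam) = fact (psize lam) * (beta_weight (beta_set M lam) :: 'f::field_char_0)"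
  using assms
proof (induction "psize lam" arbitrary: lam)
  case 0
  then show ?case using pdim_psize_0[OF 0(2)] by simp
next
  case (Suc n)
  have "(of_nat (pdim lam) :: 'f) = (\<Sum>i\<in>corners lam. of_nat (pdim (lam(i := lam i - 1))))"
    using pdim_branching[OF Suc(3)] Suc(2) by simp
  also have "\<dots> = (\<Sum>i\<in>corners lam. fact n * beta_weight (beta_set M (lam(i := lam i - 1))))"
  proof (rule sum.cong[OF refl])
    fix i assume i: "i \<in> corners lam"
    have "n = psize (lam(i := lam i - 1))" using psize_remove_corner[OF Suc(3) i] Suc(2) by simp
    then show "(of_nat (pdim (lam(i := lam i - 1))) :: 'f) = fact n * beta_weight (beta_set M (lam(i := lam i - 1)))"
      using Suc(1)[OF _ remove_corner_short[OF Suc(3) i]] by simp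
  qed
  also have "\<dots> = fact n * (of_nat (psize lam) * beta_weight (beta_set M lam))"
    by (simp only: sum_distrib_left[symmetric] sum_beta_weight_corners[OF Suc(3)])
  also have "\<dots> = fact (psize lam) * beta_weight (beta_set M lam)"
    unfolding Suc(2)[symmetric] by simp
  finally show ?case .
qed

text \<open>Separates the discriminant, needed in \<open>fay_bracket\<close>, from a product over
  single points, which goes into the weight.\<close>

lemma pdim_squared:
  assumes "lam \<in> short_partitions M"
  shows "(of_nat (pdim lam) / fact (psize lam))\<^sup>2
    = sqdisc (beta_set M lam) * (\<Prod>s\<in>beta_set M lam. 1 / (fact s)\<^sup>2 :: 'f::field_char_0)"
  unfolding pdim_eq_beta_weight[OF assms] beta_weight_def
  by (simp add: sqdisc_eq_vandermonde power_divide prod_dividef prod_power_distrib)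

section \<open>Beta sets\<close>

definition box_partitions :: "nat \<Rightarrow> nat \<Rightarrow> (nat \<Rightarrow> nat) set" where
  "box_partitions M L = {lam \<in> short_partitions M. lam 0 \<le> L}"

text \<open>Beta numbers decrease strictly along the rows, so the row index can be read off the set;
  this gives injectivity of \<open>beta_set\<close>.\<close>

lemma card_beta_set_greater:
  assumes "lam \<in> short_partitions M" "i < M"
  shows "card {s \<in> beta_set M lam. lam i + (M - 1 - i) < s} = i"
proof -
  have "{s \<in> beta_set M lam. lam i + (M - 1 - i) < s} = (\<lambda>i. lam i + (M - 1 - i)) ` {..<i}"
  proof (intro equalityI subsetI)
    fix s assume "s \<in> {s \<in> beta_set M lam. lam i + (M - 1 - i) < s}"
    then obtain j where j: "j < M" "s = lam j + (M - 1 - j)" "lam i + (M - 1 - i) < s"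
      by (auto simp: beta_set_def)
    then have "j < i" using beta_strict[OF assms(1), of i j] by (cases j i rule: linorder_cases) auto
    then show "s \<in> (\<lambda>i. lam i + (M - 1 - i)) ` {..<i}" using j by (intro image_eqI[of _ _ j]) auto
  next
    fix s assume "s \<in> (\<lambda>i. lam i + (M - 1 - i)) ` {..<i}"
    then show "s \<in> {s \<in> beta_set M lam. lam i + (M - 1 - i) < s}"
      using beta_strict[OF assms(1) _ assms(2)] assms(2) by (auto simp: beta_set_def)
  qed
  then show ?thesis
    using inj_on_subset[OF beta_inj[OF assms(1)], of "{..<i}"] assms(2)
    by (metis card_image card_lessThan lessThan_subset_iff less_imp_le)
qed

lemma beta_set_inj: "inj_on (beta_set M) (short_partitions M)"
proof (intro inj_onI ext)
  fix lam mu i assume *: "lam \<in> short_partitions M" "mu \<in> short_partitions M" "beta_set M lam = beta_set M mu"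
  show "lam i = mu i"
  proof (cases "i < M")
    case True
    then have "lam i + (M - 1 - i) \<in> beta_set M mu" unfolding *(3)[symmetric] by (auto simp: beta_set_def)
    then obtain j where j: "j < M" "lam i + (M - 1 - i) = mu j + (M - 1 - j)" by (auto simp: beta_set_def)
    then have "i = j"
      using card_beta_set_greater[OF *(1) True] card_beta_set_greater[OF *(2) j(1)] *(3) by simp
    then show ?thesis using j by simp
  qed (use * in \<open>auto simp: short_partitions_def\<close>)
qed

lemma strict_mono_on_gap:
  fixes h :: "nat \<Rightarrow> nat"
  assumes "strict_mono_on {..<M} h" "i \<le> j" "j < M"
  shows "h i + (j - i) \<le> h j"
  using assms(2,3)
proof (induction j rule: dec_induct)
  case (step j)
  then have "h j < h (Suc j)" using assms(1) by (auto simp: strict_mono_on_def)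
  then show ?case using step by simp
qed simp

lemma beta_set_bij_betw:
  "bij_betw (beta_set M) (box_partitions M L) {S. S \<subseteq> {..<M + L} \<and> card S = M}"
  unfolding bij_betw_def
proof (intro conjI equalityI subsetI)
  show "inj_on (beta_set M) (box_partitions M L)"
    by (rule inj_on_subset[OF beta_set_inj]) (auto simp: box_partitions_def)
next
  fix S assume "S \<in> beta_set M ` box_partitions M L"
  then obtain lam where lam: "lam \<in> short_partitions M" "lam 0 \<le> L" "S = beta_set M lam"
    by (auto simp: box_partitions_def)
  have "lam i \<le> L" for i using lam antimonoD[of lam 0 i] by (auto simp: short_partitions_def)
  then have "lam i + (M - 1 - i) < M + L" if "i < M" for i
    using that \<open>\<And>i. lam i \<le> L\<close>[of i] by linarith
  then show "S \<in> {S. S \<subseteq> {..<M + L} \<and> card S = M}"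
    using card_beta_set[OF lam(1)] lam(3) by (auto simp: beta_set_def)
next
  fix S assume "S \<in> {S. S \<subseteq> {..<M + L} \<and> card S = M}"
  then have S: "S \<subseteq> {..<M + L}" "card S = M" "finite S" by (auto intro: finite_subset)
  then obtain h where h: "bij_betw h {..<M} S" "strict_mono_on {..<M} h"
    using ex_bij_betw_strict_mono_card by metis
  \<comment> \<open>\<open>h\<close> enumerates \<open>S\<close> increasingly whereas beta numbers
    decrease with the row, so row \<open>i\<close> takes the element with index
    \<open>M - 1 - i\<close>. The subtraction is exact by \<open>ge\<close> below.\<close>
  define lam where "lam i = (if i < M then h (M - 1 - i) - (M - 1 - i) else 0)" for i
  have ge: "k \<le> h k" if "k < M" for k using strict_mono_on_gap[OF h(2), of 0 k] that by simp
  have "antimono lam"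
  proof (rule antimonoI)
    fix i j :: nat assume "i \<le> j"
    show "lam j \<le> lam i"
    proof (cases "j < M")
      case True
      then have "h (M - 1 - j) + ((M - 1 - i) - (M - 1 - j)) \<le> h (M - 1 - i)"
        using \<open>i \<le> j\<close> by (intro strict_mono_on_gap[OF h(2)]) auto
      then show ?thesis using True \<open>i \<le> j\<close> by (auto simp: lam_def)
    qed (auto simp: lam_def)
  qed
  moreover have "lam 0 \<le> L"
  proof (cases "M = 0")
    case False
    then have "h (M - 1) < M + L" using S(1) bij_betwE[OF h(1)] by auto
    then have "h (M - 1) - (M - 1) \<le> L" using False by linarith
    then show ?thesis using False by (simp add: lam_def)
  qed (simp add: lam_def)
  ultimately have "lam \<in> box_partitions M L"
    by (simp add: box_partitions_def short_partitions_def lam_def)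
  moreover have "beta_set M lam = S"
  proof -
    have "beta_set M lam = (\<lambda>i. h (M - 1 - i)) ` {..<M}"
      unfolding beta_set_def
    proof (rule image_cong[OF refl])
      fix i assume "i \<in> {..<M}"
      then have "M - 1 - i \<le> h (M - 1 - i)" "lam i = h (M - 1 - i) - (M - 1 - i)"
        using ge[of "M - 1 - i"] by (auto simp: lam_def)
      then show "lam i + (M - 1 - i) = h (M - 1 - i)" by linarith
    qed
    also have "\<dots> = h ` (\<lambda>i. M - 1 - i) ` {..<M}" by (simp add: image_image)
    also have "(\<lambda>i. M - 1 - i) ` {..<M} = {..<M}"
    proof (intro equalityI subsetI)
      fix k assume "k \<in> {..<M}"
      then show "k \<in> (\<lambda>i. M - 1 - i) ` {..<M}" by (intro image_eqI[of _ _ "M - 1 - k"]) auto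
    qed auto
    finally show ?thesis using h(1) by (simp add: bij_betw_def)
  qed
  ultimately show "S \<in> beta_set M ` box_partitions M L" by blast
qed

lemma sum_le_psize:
  assumes "lam \<in> partitions" "finite B"
  shows "sum lam B \<le> psize lam"
proof -
  have fin: "finite {i. lam i \<noteq> 0}" using assms by (simp add: partitions_def)
  have "sum lam B \<le> sum lam (B \<union> {i. lam i \<noteq> 0})" using assms fin by (intro sum_mono2) auto
  also have "\<dots> = psize lam"
    unfolding psize_def using assms fin by (intro Sum_any.expand_superset[symmetric]) auto
  finally show ?thesis .
qed

lemma small_partitions_in_box:
  assumes "lam \<in> partitions" "psize lam \<le> n"
  shows "lam \<in> box_partitions n n"
proof -
  have anti: "antimono lam" using assms by (simp add: partitions_def)
  have "lam i = 0" if "i \<ge> n" for i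
  proof (rule ccontr)
    assume "lam i \<noteq> 0"
    then have "1 \<le> lam j" if "j \<le> i" for j using antimonoD[OF anti that] by simp
    then have "(\<Sum>j\<in>{..i}. 1) \<le> sum lam {..i}" by (intro sum_mono) auto
    with sum_le_psize[OF assms(1), of "{..i}"] assms(2) that show False by simp
  qed
  moreover have "lam 0 \<le> n" using sum_le_psize[OF assms(1), of "{0}"] assms(2) by simp
  ultimately show ?thesis using anti by (simp add: box_partitions_def short_partitions_def)
qed

lemma finite_box_partitions: "finite (box_partitions M L)"
proof -
  have "finite {S. S \<subseteq> {..<M + L} \<and> card S = M}" by simp
  then show ?thesis using bij_betw_finite[OF beta_set_bij_betw[of M L]] by simp
qed

text \<open>For \<open>s = lam i + (M - 1 - i)\<close> one has \<open>lam i - i = s + 1 - M\<close>.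
  Up to a term independent of \<open>lam\<close>, \<open>phi_4D\<close> is thus a sum over the beta
  set.\<close>

lemma phi_4D_beta_set:
  assumes "lam \<in> short_partitions M"
  shows "phi_4D k lam = (\<Sum>s\<in>beta_set M lam. (int s + 1 - int M) ^ k) - (\<Sum>i<M. (- int i) ^ k)"
proof -
  have "phi_4D k lam = (\<Sum>i<M. (int (lam i) - int i) ^ k - (- int i) ^ k)"
    unfolding phi_4D_def
    by (rule Sum_any.expand_superset) (use assms in \<open>auto simp: short_partitions_def not_less[symmetric]\<close>)
  also have "\<dots> = (\<Sum>i<M. (int (lam i) - int i) ^ k) - (\<Sum>i<M. (- int i) ^ k)" by (rule sum_subtractf)
  also have "(\<Sum>i<M. (int (lam i) - int i) ^ k) = (\<Sum>i<M. (int (lam i + (M - 1 - i)) + 1 - int M) ^ k)"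
    by (intro sum.cong) (auto simp: of_nat_diff)
  finally show ?thesis by (simp only: sum_beta_set[OF assms])
qed

section \<open>Truncation of the partition function\<close>

text \<open>The times get weight 0, so truncation bounds the size of the partitions while keeping
  the full dependence on all \<open>Time k\<close>.\<close>

definition lam_deg :: "(param \<Rightarrow>\<^sub>0 nat) \<Rightarrow> nat" where
  "lam_deg m = Poly_Mapping.lookup m LambdaSq"

lemma lam_deg_add: "lam_deg (a + b) = lam_deg a + lam_deg b"
  by (simp add: lam_deg_def lookup_add)

lemma mps_coeff_Z_4D_summand_eq_0:
  assumes "lam_deg m < psize lam"
  shows "mps_coeff (Z_4D_summand h Xs lam) m = 0"
proof -
  have zero: "mps_coeff (mps_var LambdaSq ^ psize lam * c :: (param, 'a) mps) m = 0" for c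
  proof (rule mps_coeff_mult_eq_0[of lam_deg "psize lam" _ 0])
    fix a assume "lam_deg a < psize lam"
    then show "mps_coeff (mps_var LambdaSq ^ psize lam :: (param, 'a) mps) a = 0"
      by (intro mps_coeff_power_eq_0[of lam_deg, OF lam_deg_add]) (auto simp: mps_coeff_var lam_deg_def)
  qed (use assms in \<open>auto simp: lam_deg_add\<close>)
  have comm: "x * (y * v) * z * w = v * (x * y * z * w)" for x y z w v :: "(param, 'a) mps"
    by (simp only: mult_ac)
  show ?thesis unfolding Z_4D_summand_def comm by (rule zero)
qed

text \<open>Partitions larger than \<open>n\<close> contribute nothing in this range, and the others
  fit into the box. Summing over the whole box, rather than over sizes up to \<open>n\<close>, makes
  the beta sets run through all \<open>n\<close>-subsets of \<open>{..<n + n}\<close>.\<close>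

lemma Z_4D_cong_box:
  "mps_cong lam_deg n (Z_4D h Xs) (\<Sum>lam\<in>box_partitions n n. Z_4D_summand h Xs lam)"
  unfolding mps_cong_def
proof (intro allI impI)
  fix m assume m: "lam_deg m \<le> n"
  have "box_partitions n n \<subseteq> partitions"
    using short_partitions_subset by (auto simp: box_partitions_def)
  then have box: "(\<Sum>lam\<in>box_partitions n n. if lam \<in> partitions then mps_coeff (Z_4D_summand h Xs lam) m else 0)
      = (\<Sum>lam\<in>box_partitions n n. mps_coeff (Z_4D_summand h Xs lam) m)"
    by (intro sum.cong) auto
  have "mps_coeff (Z_4D h Xs) m
      = Sum_any (\<lambda>lam. if lam \<in> partitions then mps_coeff (Z_4D_summand h Xs lam) m else 0)"
    by (simp add: Z_4D_def mps_sum_def)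
  also have "\<dots> = (\<Sum>lam\<in>box_partitions n n. if lam \<in> partitions then mps_coeff (Z_4D_summand h Xs lam) m else 0)"
  proof (rule Sum_any.expand_superset[OF finite_box_partitions], rule subsetI)
    fix lam assume "lam \<in> {lam. (if lam \<in> partitions then mps_coeff (Z_4D_summand h Xs lam) m else 0) \<noteq> 0}"
    then have lam: "lam \<in> partitions" "mps_coeff (Z_4D_summand h Xs lam) m \<noteq> 0" by (auto split: if_splits)
    then have "psize lam \<le> n" using mps_coeff_Z_4D_summand_eq_0[of m lam h Xs] m by force
    then show "lam \<in> box_partitions n n" by (rule small_partitions_in_box[OF lam(1)])
  qed
  finally show "mps_coeff (Z_4D h Xs) m = mps_coeff (\<Sum>lam\<in>box_partitions n n. Z_4D_summand h Xs lam) m"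
    by (simp add: mps_coeff_sum box)
qed

text \<open>The coordinate in which the zeros of the numerator become the beta numbers:
  \<open>x - (lam i - i) * h\<close> is \<open>h\<close> times the distance from
  \<open>beta_coord M h x\<close> to the beta number of row \<open>i\<close>.\<close>

definition beta_coord :: "nat \<Rightarrow> 'f \<Rightarrow> 'f \<Rightarrow> 'f::field_char_0" where
  "beta_coord M h x = x / h + of_nat M - 1"

text \<open>Collects the denominators and the powers of \<open>h\<close>; it does not depend on the
  partition and leaves the sum.\<close>

definition vacuum_factor :: "nat \<Rightarrow> 'f \<Rightarrow> 'f \<Rightarrow> 'f::field_char_0" where
  "vacuum_factor M h x = h ^ M / (\<Prod>i<M. x + of_nat i * h)"

text \<open>Rows from \<open>M\<close> on contribute 1. This rests on the denominators being
  nonzero, as \<open>0 / 0\<close> has the default value 0.\<close>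

lemma Prod_any_ratio:
  fixes x h :: "'f::field_char_0"
  assumes "lam \<in> short_partitions M" "h \<noteq> 0" "\<And>i. x + of_nat i * h \<noteq> 0"
  shows "Prod_any (\<lambda>i. (x - of_int (int (lam i) - int i) * h) / (x - of_int (- int i) * h))
    = vacuum_factor M h x * node_poly (beta_set M lam) (beta_coord M h x)"
proof -
  have "Prod_any (\<lambda>i. (x - of_int (int (lam i) - int i) * h) / (x - of_int (- int i) * h))
    = (\<Prod>i<M. (x - of_int (int (lam i) - int i) * h) / (x - of_int (- int i) * h))"
    by (rule Prod_any.expand_superset)
      (use assms in \<open>auto simp: short_partitions_def not_less[symmetric]\<close>)
  also have "\<dots> = (\<Prod>i<M. h * (beta_coord M h x - of_nat (lam i + (M - 1 - i))) / (x + of_nat i * h))"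
  proof (rule prod.cong[OF refl])
    fix i assume "i \<in> {..<M}"
    then have "h * (beta_coord M h x - of_nat (lam i + (M - 1 - i))) = x - of_int (int (lam i) - int i) * h"
      using assms(2) by (simp add: beta_coord_def of_nat_diff field_simps)
    then show "(x - of_int (int (lam i) - int i) * h) / (x - of_int (- int i) * h)
        = h * (beta_coord M h x - of_nat (lam i + (M - 1 - i))) / (x + of_nat i * h)" by simp
  qed
  also have "\<dots> = vacuum_factor M h x * (\<Prod>i<M. beta_coord M h x - of_nat (lam i + (M - 1 - i)))"
    by (simp add: prod_dividef prod.distrib vacuum_factor_def)
  finally show ?thesis by (simp only: node_poly_def prod_beta_set[OF assms(1)])
qed

text \<open>The weight \<open>\<Omega>(S)\<close>: the summand without its discriminant and without
  its dependence on the variables.\<close>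

definition partition_weight :: "nat \<Rightarrow> 'f \<Rightarrow> (nat \<Rightarrow> nat) \<Rightarrow> (param, 'f::field_char_0) mps" where
  "partition_weight M h lam = mps_const (\<Prod>s\<in>beta_set M lam. 1 / (fact s)\<^sup>2)
     * (mps_const ((1 / h) ^ (2 * psize lam)) * mps_var LambdaSq ^ psize lam)
     * mps_exp (time_potential lam)"

text \<open>Every ingredient is a product over the beta set, or a power or exponential of a sum over
  it, up to terms common to all partitions. For two sets such sums and products are determined by
  the intersection and the union.\<close>

lemma partition_weight_mult_cong:
  assumes "lam \<in> short_partitions M" "mu \<in> short_partitions M"
    "lam' \<in> short_partitions M" "mu' \<in> short_partitions M"
    and Int: "beta_set M lam \<inter> beta_set M mu = beta_set M lam' \<inter> beta_set M mu'"
    and Un: "beta_set M lam \<union> beta_set M mu = beta_set M lam' \<union> beta_set M mu'"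
  shows "partition_weight M h lam * partition_weight M h mu
    = partition_weight M h lam' * (partition_weight M h mu' :: (param, 'f::field_char_0) mps)"
proof -
  have sums: "sum g (beta_set M lam) + sum g (beta_set M mu) = sum g (beta_set M lam') + sum g (beta_set M mu')"
    for g :: "nat \<Rightarrow> 'b::comm_monoid_add"
    using sum.union_inter[of "beta_set M lam" "beta_set M mu" g] sum.union_inter[of "beta_set M lam'" "beta_set M mu'" g] Int Un
    by simp
  have prods: "prod g (beta_set M lam) * prod g (beta_set M mu) = prod g (beta_set M lam') * prod g (beta_set M mu')"
    for g :: "nat \<Rightarrow> 'f"
    using prod.union_inter[of "beta_set M lam" "beta_set M mu" g] prod.union_inter[of "beta_set M lam'" "beta_set M mu'" g] Int Un
    by simp
  have size: "psize lam + psize mu = psize lam' + psize mu'"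
    using sums[of "\<lambda>s. s"] assms(1-4) by (simp add: sum_beta_set_eq)
  have "phi_4D k lam + phi_4D k mu = phi_4D k lam' + phi_4D k mu'" for k
    using sums[of "\<lambda>s. (int s + 1 - int M) ^ k"] assms(1-4) by (simp add: phi_4D_beta_set)
  then have "time_potential lam + time_potential mu = (time_potential lam' + time_potential mu' :: (param, 'f) mps)"
    by (intro time_potential_add_cong)
  then have exps: "mps_exp (time_potential lam) * mps_exp (time_potential mu)
      = (mps_exp (time_potential lam') * mps_exp (time_potential mu') :: (param, 'f) mps)"
    by (simp add: mps_exp_add mps_coeff_time_potential_0)
  have mult: "partition_weight M h a * partition_weight M h b
      = mps_const ((\<Prod>s\<in>beta_set M a. 1 / (fact s)\<^sup>2) * (\<Prod>s\<in>beta_set M b. 1 / (fact s)\<^sup>2))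
        * (mps_const ((1 / h) ^ (2 * (psize a + psize b))) * mps_var LambdaSq ^ (psize a + psize b))
        * (mps_exp (time_potential a) * mps_exp (time_potential b) :: (param, 'f) mps)" for a b
    unfolding partition_weight_def by (simp only: mps_const_mult power_add distrib_left mult_ac)
  show ?thesis unfolding mult by (simp only: exps prods size)
qed

lemma Z_4D_summand_beta_set:
  fixes x y h :: "'f::field_char_0"
  assumes "lam \<in> short_partitions M" "h \<noteq> 0" "\<And>i. x + of_nat i * h \<noteq> 0" "\<And>i. y + of_nat i * h \<noteq> 0"
  shows "Z_4D_summand h [x, y] lam = mps_const (vacuum_factor M h x * vacuum_factor M h y)
    * (partition_weight M h lam
      * mps_const (sqdisc (beta_set M lam) * (node_poly (beta_set M lam) (beta_coord M h x)
          * node_poly (beta_set M lam) (beta_coord M h y))))"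
  unfolding Z_4D_summand_def partition_weight_def of_nat_fact pdim_squared[OF assms(1)]
    list.map prod_list.Cons prod_list.Nil mult_1_right Prod_any_ratio[OF assms(1,2,3)] Prod_any_ratio[OF assms(1,2,4)]
  by (simp only: mps_const_mult mult_ac)

lemma sum_box_Z_4D_summand:
  fixes x y h :: "'f::field_char_0"
  assumes "h \<noteq> 0" "\<And>i. x + of_nat i * h \<noteq> 0" "\<And>i. y + of_nat i * h \<noteq> 0"
  shows "(\<Sum>lam\<in>box_partitions M L. Z_4D_summand h [x, y] lam)
    = mps_const (vacuum_factor M h x * vacuum_factor M h y)
      * (\<Sum>S | S \<subseteq> {..<M + L} \<and> card S = M.
          partition_weight M h (the_inv_into (box_partitions M L) (beta_set M) S)
          * mps_const (sqdisc S * (node_poly S (beta_coord M h x) * node_poly S (beta_coord M h y))))"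
proof -
  note bij = beta_set_bij_betw[of M L]
  have "(\<Sum>lam\<in>box_partitions M L. Z_4D_summand h [x, y] lam)
      = mps_const (vacuum_factor M h x * vacuum_factor M h y) * (\<Sum>lam\<in>box_partitions M L.
          partition_weight M h (the_inv_into (box_partitions M L) (beta_set M) (beta_set M lam))
          * mps_const (sqdisc (beta_set M lam) * (node_poly (beta_set M lam) (beta_coord M h x)
          * node_poly (beta_set M lam) (beta_coord M h y))))"
    unfolding sum_distrib_left
    by (intro sum.cong) (use bij in \<open>auto simp: bij_betw_def box_partitions_def the_inv_into_f_f
      intro!: Z_4D_summand_beta_set assms\<close>)
  also have "(\<Sum>lam\<in>box_partitions M L.
          partition_weight M h (the_inv_into (box_partitions M L) (beta_set M) (beta_set M lam))
          * mps_const (sqdisc (beta_set M lam) * (node_poly (beta_set M lam) (beta_coord M h x)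
          * node_poly (beta_set M lam) (beta_coord M h y))))
      = (\<Sum>S | S \<subseteq> {..<M + L} \<and> card S = M.
          partition_weight M h (the_inv_into (box_partitions M L) (beta_set M) S)
          * mps_const (sqdisc S * (node_poly S (beta_coord M h x) * node_poly S (beta_coord M h y))))"
    by (rule sum.reindex_bij_betw[OF bij])
  finally show ?thesis .
qed

theorem Z_4D_three_term:
  fixes x1 x2 x3 x4 h :: "'f::field_char_0"
  assumes h: "h \<noteq> 0" and x: "\<And>x i. x \<in> {x1, x2, x3, x4} \<Longrightarrow> x + of_nat i * h \<noteq> 0"
  shows "mps_const ((x1 - x2) * (x3 - x4)) * Z_4D h [x1, x2] * Z_4D h [x3, x4]
    - mps_const ((x1 - x3) * (x2 - x4)) * Z_4D h [x1, x3] * Z_4D h [x2, x4]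
    + mps_const ((x1 - x4) * (x2 - x3)) * Z_4D h [x1, x4] * Z_4D h [x2, x3] = 0"
proof (rule mps_eqI_cong[of lam_deg])
  \<comment> \<open>Equality is checked up to each order \<open>n\<close> in
    \<open>LambdaSq\<close>, with the \<open>n\<close> by \<open>n\<close> box as the finite
    model.\<close>
  fix n
  define Zn where "Zn x y = (\<Sum>lam\<in>box_partitions n n. Z_4D_summand h [x, y] lam)" for x y
  define inv where "inv = the_inv_into (box_partitions n n) (beta_set n)"
  define F where "F x y = (\<Sum>S | S \<subseteq> {..<n + n} \<and> card S = n. partition_weight n h (inv S)
     * mps_const (sqdisc S * (node_poly S x * node_poly S y)))" for x y :: 'f
  let ?c = "mps_const :: 'f \<Rightarrow> (param, 'f) mps" and ?b = "beta_coord n h" and ?v = "vacuum_factor n h"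
  have Zn: "Zn x y = ?c (?v x * ?v y) * F (?b x) (?b y)"
    if "x \<in> {x1, x2, x3, x4}" "y \<in> {x1, x2, x3, x4}" for x y
    unfolding Zn_def F_def inv_def by (rule sum_box_Z_4D_summand[OF h x[OF that(1)] x[OF that(2)]])
  have diff: "x - y = h * (?b x - ?b y)" for x y
    using h by (simp add: beta_coord_def field_simps)
  \<comment> \<open>All three terms acquire the same constant: \<open>h\<close> from each of the two
    differences and one vacuum factor per variable.\<close>
  have scale: "?c ((x - y) * (z - w)) * Zn x y * Zn z w
      = ?c (h * h * (?v x * ?v y * ?v z * ?v w)) * (?c ((?b x - ?b y) * (?b z - ?b w)) * F (?b x) (?b y) * F (?b z) (?b w))"
    if "x \<in> {x1, x2, x3, x4}" "y \<in> {x1, x2, x3, x4}" "z \<in> {x1, x2, x3, x4}" "w \<in> {x1, x2, x3, x4}" for x y z w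
    unfolding Zn[OF that(1,2)] Zn[OF that(3,4)] diff[of x y] diff[of z w]
    by (simp only: mps_const_mult mult_ac)
  have combine: "a - b + c = K * (a' - b' + c')" if "a = K * a'" "b = K * b'" "c = K * c'"
    for a b c a' b' c' K :: "(param, 'f) mps"
    using that by (simp add: right_diff_distrib distrib_left)
  let ?K = "?c (h * h * (?v x1 * ?v x2 * ?v x3 * ?v x4))"
  have perm: "?v x1 * ?v x3 * ?v x2 * ?v x4 = ?v x1 * ?v x2 * ?v x3 * ?v x4"
    "?v x1 * ?v x4 * ?v x2 * ?v x3 = ?v x1 * ?v x2 * ?v x3 * ?v x4"
    by (simp_all only: mult_ac)
  have inv: "inv S \<in> short_partitions n" "beta_set n (inv S) = S" if "S \<subseteq> {..<n + n}" "card S = n" for S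
    using that bij_betw_the_inv_into[OF beta_set_bij_betw[of n n]] f_the_inv_into_f_bij_betw[OF beta_set_bij_betw[of n n]]
    unfolding inv_def by (auto simp: box_partitions_def dest!: bij_betwE)
  have three: "?c ((y1 - y2) * (y3 - y4)) * F y1 y2 * F y3 y4 - ?c ((y1 - y3) * (y2 - y4)) * F y1 y3 * F y2 y4
    + ?c ((y1 - y4) * (y2 - y3)) * F y1 y4 * F y2 y3 = 0" for y1 y2 y3 y4
    unfolding F_def
  proof (rule three_term_subsets)
    fix S S' U U'
    assume sub: "{S, S', U, U'} \<subseteq> {S. S \<subseteq> {..<n + n} \<and> card S = n}" and "S \<inter> S' = U \<inter> U'" "S \<union> S' = U \<union> U'"
    then show "partition_weight n h (inv S) * partition_weight n h (inv S')
        = partition_weight n h (inv U) * partition_weight n h (inv U')"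
      by (intro partition_weight_mult_cong) (simp_all add: inv)
  qed (simp_all add: mps_const_add mps_const_mult)
  have "?c ((x1 - x2) * (x3 - x4)) * Zn x1 x2 * Zn x3 x4 - ?c ((x1 - x3) * (x2 - x4)) * Zn x1 x3 * Zn x2 x4
    + ?c ((x1 - x4) * (x2 - x3)) * Zn x1 x4 * Zn x2 x3
    = ?K * (?c ((?b x1 - ?b x2) * (?b x3 - ?b x4)) * F (?b x1) (?b x2) * F (?b x3) (?b x4)
     - ?c ((?b x1 - ?b x3) * (?b x2 - ?b x4)) * F (?b x1) (?b x3) * F (?b x2) (?b x4)
     + ?c ((?b x1 - ?b x4) * (?b x2 - ?b x3)) * F (?b x1) (?b x4) * F (?b x2) (?b x3))"
    by (rule combine) (use scale[of x1 x2 x3 x4] scale[of x1 x3 x2 x4] scale[of x1 x4 x2 x3] in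
        \<open>simp_all only: perm insert_iff simp_thms\<close>)
  then have 0: "?c ((x1 - x2) * (x3 - x4)) * Zn x1 x2 * Zn x3 x4 - ?c ((x1 - x3) * (x2 - x4)) * Zn x1 x3 * Zn x2 x4
    + ?c ((x1 - x4) * (x2 - x3)) * Zn x1 x4 * Zn x2 x3 = 0"
    unfolding three by simp
  have cong: "mps_cong lam_deg n (Z_4D h [x, y]) (Zn x y)" for x y
    unfolding Zn_def by (rule Z_4D_cong_box)
  have "mps_cong lam_deg n (?c ((x1 - x2) * (x3 - x4)) * Z_4D h [x1, x2] * Z_4D h [x3, x4]
    - ?c ((x1 - x3) * (x2 - x4)) * Z_4D h [x1, x3] * Z_4D h [x2, x4]
    + ?c ((x1 - x4) * (x2 - x3)) * Z_4D h [x1, x4] * Z_4D h [x2, x3])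
    (?c ((x1 - x2) * (x3 - x4)) * Zn x1 x2 * Zn x3 x4 - ?c ((x1 - x3) * (x2 - x4)) * Zn x1 x3 * Zn x2 x4
    + ?c ((x1 - x4) * (x2 - x3)) * Zn x1 x4 * Zn x2 x3)"
    by (intro mps_cong_add mps_cong_diff mps_cong_mult lam_deg_add mps_cong_refl cong)
  then show "mps_cong lam_deg n (?c ((x1 - x2) * (x3 - x4)) * Z_4D h [x1, x2] * Z_4D h [x3, x4]
    - ?c ((x1 - x3) * (x2 - x4)) * Z_4D h [x1, x3] * Z_4D h [x2, x4]
    + ?c ((x1 - x4) * (x2 - x3)) * Z_4D h [x1, x4] * Z_4D h [x2, x3]) 0"
    unfolding 0 .
qed

section \<open>Rational functions\<close>

lemma of_nat_fract: "of_nat n = to_fract (of_nat n :: 'a::idom)"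
  by (induction n) simp_all

text \<open>Allows the field version of the relation to be applied to rational functions.\<close>

instance fract :: ("{idom, ring_char_0}") field_char_0
proof
  show "inj (of_nat :: nat \<Rightarrow> 'a fract)"
    by (rule injI) (simp add: of_nat_fract)
qed

text \<open>The coefficient at the monomial of \<open>X j\<close> is 1, so the denominators do not
  vanish.\<close>

lemma X_add_rat_const_nonzero: "X j + of_nat i * rat_const h \<noteq> (0 :: 'a::idom ratfun)"
proof
  assume "X j + of_nat i * rat_const h = (0 :: 'a ratfun)"
  moreover have "of_nat i * rat_const h = to_fract (Poly_Mapping.single (0 :: nat \<Rightarrow>\<^sub>0 nat) (of_nat i * h))"
    unfolding rat_const_def of_nat_fract to_fract_mult[symmetric] single_of_nat[symmetric] mult_single by simp
  ultimately have "to_fract (Poly_Mapping.single (Poly_Mapping.single j (1::nat)) 1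
      + Poly_Mapping.single 0 (of_nat i * h)) = (0 :: 'a ratfun)"
    by (simp add: X_def)
  then have "Poly_Mapping.single (Poly_Mapping.single j (1::nat)) 1 + Poly_Mapping.single 0 (of_nat i * h) = (0 :: _ \<Rightarrow>\<^sub>0 'a)"
    by (simp only: to_fract_eq_0_iff)
  then have "Poly_Mapping.lookup (Poly_Mapping.single (Poly_Mapping.single j (1::nat)) 1
      + Poly_Mapping.single 0 (of_nat i * h)) (Poly_Mapping.single j 1) = (0 :: 'a)"
    by simp
  moreover have "Poly_Mapping.single j (1::nat) \<noteq> 0"
    by (metis lookup_single_eq lookup_zero one_neq_zero)
  ultimately show False
    by (simp add: lookup_add lookup_single when_def)
qed

theorem mainTheorem7:
  fixes hbar :: "'a::field_char_0"
  assumes "hbar \<noteq> 0"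
  shows
    "mps_const ((X 1 - X 2) * (X 3 - X 4)) *
       Z_4D (rat_const hbar) [X 1, X 2] * Z_4D (rat_const hbar) [X 3, X 4]
     - mps_const ((X 1 - X 3) * (X 2 - X 4)) *
       Z_4D (rat_const hbar) [X 1, X 3] * Z_4D (rat_const hbar) [X 2, X 4]
     + mps_const ((X 1 - X 4) * (X 2 - X 3)) *
       Z_4D (rat_const hbar) [X 1, X 4] * Z_4D (rat_const hbar) [X 2, X 3]
     = 0"
proof (rule Z_4D_three_term)
  show "rat_const hbar \<noteq> 0"
    using assms unfolding rat_const_def to_fract_eq_0_iff by (metis lookup_single_eq lookup_zero)
qed (auto simp: X_add_rat_const_nonzero)

end
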